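(* Let $R$ be an FGFC-ring and let $X$ be a (possibly infinite) set of indeterminates over $R$. Then the polynomial ring $R[X]$ is an FGFC-ring.
   Context: All rings are commutative with identity. For a ring $A$ and an $A$-module $M$, let $\operatorname{Supp}_A M$ denote the support of $M$ and let $\operatorname{Min}_A M$ denote the set of minimal elements (with respect to inclusion) of $\operatorname{Supp}_A M$. An $A$-module $M$ is said to be FGFC if for every finitely generated $A$-submodule $N$ of $M$, $\operatorname{Supp}_A (M/N)$ is a finite union of irreducible closed subsets of $\operatorname{Spec} A$; equivalently, $\operatorname{Min}_A (M/N)$ is a finite set. A ring $A$ is an FGFC-ring if it is FGFC as an $A$-module; that is, for every finitely generated ideal $I$ of $A$, the set of primes of $A$ minimal over $I$ is finite. *)

theory Defs
  imports "HOL-Algebra.Algebra"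
begin

definition minimal_primes_over :: "('a, 'm) ring_scheme \<Rightarrow> 'a set \<Rightarrow> 'a set set"
  where "minimal_primes_over A I =
    {P. primeideal P A \<and> I \<subseteq> P \<and> (\<forall>Q. primeideal Q A \<and> I \<subseteq> Q \<and> Q \<subseteq> P \<longrightarrow> Q = P)}"

(* Supp_A (A/I) is the set of primes containing I, so its minimal elements are the primes
   minimal over I. The zero ring is allowed. *)
definition fgfc_ring :: "('a, 'm) ring_scheme \<Rightarrow> bool"
  where "fgfc_ring A \<longleftrightarrow> cring A \<and>
    (\<forall>S. finite S \<and> S \<subseteq> carrier A \<longrightarrow> finite (minimal_primes_over A (Idl\<^bsub>A\<^esub> S)))"

(* HOL-Algebra has the carrier of R[V], with polynomials as functions from monomials (finite
   multisets of indeterminates) to coefficients, but no product of two such polynomials; here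
   it is the convolution. A multiset has only finitely many decompositions m = a + b, so the
   sum is finite. V may be empty, finite or infinite. *)
definition indexed_poly_ring ::
    "('a, 'm) ring_scheme \<Rightarrow> 'c set \<Rightarrow> ('c multiset \<Rightarrow> 'a) ring"
  where "indexed_poly_ring R V =
    \<lparr> carrier = ring.indexed_pset R V (carrier R),
      monoid.mult = (\<lambda>p q m. \<Oplus>\<^bsub>R\<^esub>ab \<in> {(a, b). a + b = m}. p (fst ab) \<otimes>\<^bsub>R\<^esub> q (snd ab)),
      one = ring.indexed_const R \<one>\<^bsub>R\<^esub>,
      ring.zero = ring.indexed_const R \<zero>\<^bsub>R\<^esub>,
      ring.add = ring.indexed_padd R \<rparr>"

end

theory Submission
  imports Defs "HOL-Algebra.UnivPoly"
begin

text \<open>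
  In one variable, one shows by induction on the sum of the degrees of a finite set \<open>F\<close> of polynomials
  that for every \<open>a \<in> R\<close> only finitely many primes are minimal among those containing \<open>F\<close> and not
  \<open>a\<close>. Let \<open>c\<close> be the leading coefficient of a nonconstant \<open>f \<in> F\<close> of least degree. The primes
  containing \<open>c\<close> allow \<open>f\<close> to be replaced by \<open>c\<close> and the tail of \<open>f\<close>; the primes not containing \<open>c\<close>
  allow any other nonconstant generator to be replaced by its pseudo-remainder modulo \<open>f\<close>. If all
  generators are constant, the minimal primes are extensions of minimal primes of \<open>R\<close>. If \<open>f\<close> is the
  only nonconstant one, going down shows that the minimal primes not containing \<open>c\<close> lie over minimal
  primes of \<open>R\<close>, and each fibre contributes finitely many since \<open>f\<close> has finitely many prime factors
  over the residue field.

  A finite set of generators involves finitely many variables only, and adjoining further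
  variables, even infinitely many, does not create minimal primes, because the extension of a prime
  ideal to a polynomial ring is prime.
\<close>

section \<open>Prime ideals and minimal primes\<close>

text \<open>Inverting a leading coefficient or reducing modulo a prime changes the ring, so an
  induction would have to range over localizations and quotients. Both are encoded inside
  \<open>R[x]\<close> instead: the coefficients inverted so far are collected in one factor
  \<open>a\<close> that the primes must avoid, and a residue field is replaced by congruence modulo
  \<open>L[x]\<close> together with cancellation of constants outside \<open>L\<close>.

  The split by \<open>c\<close> is forced. Pseudo-division by \<open>f\<close> and going down for
  \<open>f\<close> both require \<open>c\<close> to be invertible. Where \<open>c\<close> vanishes,
  a minimal prime may contract to a prime of \<open>R\<close> that is not minimal over the constant
  generators: for \<open>f = c x\<close> over a domain with \<open>c\<close> prime, the prime
  generated by \<open>c\<close> is minimal over \<open>f\<close>, but its contraction is not minimal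
  over zero. Adding \<open>c\<close> to the generators repairs this, and a constant does not
  increase the sum of the degrees. The set of generators must stay finite throughout, because the
  hypothesis on \<open>R\<close> bounds only the primes minimal over finitely generated
  ideals.\<close>

lemma (in cring) ideal_criterion:
  assumes "I \<subseteq> carrier R" "\<zero> \<in> I"
    and "\<And>a b. a \<in> I \<Longrightarrow> b \<in> I \<Longrightarrow> a \<oplus> b \<in> I"
    and mult: "\<And>a x. a \<in> I \<Longrightarrow> x \<in> carrier R \<Longrightarrow> x \<otimes> a \<in> I"
  shows "ideal I R"
proof (rule idealI)
  show "ring R" ..
  show "subgroup I (add_monoid R)"
  proof (rule add.subgroupI)
    show "\<ominus> a \<in> I" if "a \<in> I" for a
      using mult[OF that, of "\<ominus> \<one>"] that assms(1) by (simp add: l_minus subset_iff)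
  qed (use assms in auto)
  show "a \<otimes> x \<in> I" if "a \<in> I" "x \<in> carrier R" for a x
    using mult[OF that] that assms(1) m_comm by (metis subsetD)
qed (use mult in blast)

lemma (in ideal) diff_closed:
  assumes "a \<in> I" "b \<in> I"
  shows "a \<ominus> b \<in> I"
  using assms by (simp add: a_minus_def)

lemma (in ideal) mem_diff_cancel:
  assumes "a \<oplus> b \<in> I" "b \<in> I" "a \<in> carrier R"
  shows "a \<in> I"
proof -
  have b: "b \<in> carrier R" using assms(2) Icarr by blast
  have "(a \<oplus> b) \<ominus> b \<in> I" using assms by (intro diff_closed)
  also have "(a \<oplus> b) \<ominus> b = a"
    using b assms(3) by (simp add: a_minus_def a_assoc r_neg)
  finally show ?thesis .
qed

lemma (in cring) colon_ideal:
  assumes "ideal P R" "c \<in> carrier R"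
  shows "ideal {x \<in> carrier R. x \<otimes> c \<in> P} R"
proof -
  interpret P: ideal P R by fact
  show ?thesis
    by (rule ideal_criterion)
       (use assms(2) in \<open>auto simp: l_distr m_assoc intro: P.I_l_closed\<close>)
qed

text \<open>Krull's argument: an ideal maximal among those that contain \<open>I\<close> and miss
  \<open>M\<close> is prime.\<close>

lemma (in cring) exists_prime_avoiding:
  assumes I: "ideal I R" and disj: "I \<inter> M = {}"
    and M: "M \<subseteq> carrier R" "M \<noteq> {}" "\<And>a b. a \<in> M \<Longrightarrow> b \<in> M \<Longrightarrow> a \<otimes> b \<in> M"
  shows "\<exists>P. primeideal P R \<and> I \<subseteq> P \<and> P \<inter> M = {}"
proof -
  let ?A = "{J. ideal J R \<and> I \<subseteq> J \<and> J \<inter> M = {}}"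
  have "\<exists>P\<in>?A. \<forall>J\<in>?A. P \<subseteq> J \<longrightarrow> J = P"
  proof (rule subset_Zorn_nonempty)
    show "?A \<noteq> {}" using I disj by blast
    fix C assume C: "C \<noteq> {}" "subset.chain ?A C"
    have CA: "\<And>J. J \<in> C \<Longrightarrow> ideal J R" and dis: "\<And>J. J \<in> C \<Longrightarrow> I \<subseteq> J \<and> J \<inter> M = {}"
      using C(2) by (auto simp: subset.chain_def)
    have "ideal (\<Union>C) R"
    proof (rule ideal_criterion)
      show "\<Union>C \<subseteq> carrier R" using ideal.Icarr[OF CA] by auto
      obtain J where "J \<in> C" using C(1) by blast
      then show "\<zero> \<in> \<Union>C"
        using additive_subgroup.zero_closed[OF ideal.axioms(1)[OF CA]] by auto
      fix a b assume "a \<in> \<Union>C" "b \<in> \<Union>C"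
      then obtain J K where JK: "a \<in> J" "b \<in> K" "J \<in> C" "K \<in> C" by blast
      have "J \<subseteq> K \<or> K \<subseteq> J" using C(2) JK(3,4) by (simp add: subset_chain_def)
      then obtain L where L: "L \<in> C" "a \<in> L" "b \<in> L" using JK by auto
      then show "a \<oplus> b \<in> \<Union>C"
        using additive_subgroup.a_closed[OF ideal.axioms(1)[OF CA[OF L(1)]]] by auto
    next
      fix a x assume "a \<in> \<Union>C" "x \<in> carrier R"
      then show "x \<otimes> a \<in> \<Union>C" using ideal.I_l_closed[OF CA] by auto
    qed
    then show "\<Union>C \<in> ?A" using C(1) dis by blast
  qed
  then obtain P where P: "ideal P R" "I \<subseteq> P" "P \<inter> M = {}"
    and max: "\<And>J. ideal J R \<Longrightarrow> P \<subseteq> J \<Longrightarrow> J \<noteq> P \<Longrightarrow> J \<inter> M \<noteq> {}"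
    by (smt (verit) mem_Collect_eq subset_trans)
  interpret P: ideal P R by fact
  \<comment> \<open>Maximality enters through the colon ideal of \<open>P\<close> by
    \<open>c\<close>. It contains \<open>P\<close>, properly because of \<open>x\<close>, and hence
    meets \<open>M\<close>. Applied first to \<open>b\<close> and then to the \<open>m\<close> so
    found, this puts a product of two members of \<open>M\<close> into \<open>P\<close>.\<close>
  have meets: "\<exists>m\<in>M. m \<otimes> c \<in> P"
    if "c \<in> carrier R" "x \<in> carrier R" "x \<otimes> c \<in> P" "x \<notin> P" for c x
  proof -
    let ?J = "{x \<in> carrier R. x \<otimes> c \<in> P}"
    have "P \<subseteq> ?J" using that(1) P.I_r_closed P.Icarr by blast
    then have "?J \<inter> M \<noteq> {}"
      using max[OF colon_ideal[OF P(1) that(1)]] that by blast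
    then show ?thesis by blast
  qed
  have "primeideal P R"
  proof (rule primeidealI)
    show "carrier R \<noteq> P" using M P(3) by blast
    fix a b assume ab: "a \<in> carrier R" "b \<in> carrier R" "a \<otimes> b \<in> P"
    show "a \<in> P \<or> b \<in> P"
    proof (rule ccontr)
      assume n: "\<not> (a \<in> P \<or> b \<in> P)"
      then obtain m where m: "m \<in> M" "m \<otimes> b \<in> P"
        using meets[of b a] ab by blast
      then have "b \<otimes> m \<in> P" using m_comm ab M(1) by auto
      then obtain m' where "m' \<in> M" "m' \<otimes> m \<in> P"
        using meets[of m b] ab m n M(1) by blast
      then show False using M(3) m(1) P(3) by blast
    qed
  qed (use P in \<open>auto simp: is_cring\<close>)
  then show ?thesis using P by blast
qed

lemma (in primeideal) one_notin: "\<one> \<notin> I"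
  using I_notcarr one_imp_carrier by blast

lemma (in primeideal) mult_notin:
  assumes "a \<in> carrier R" "b \<in> carrier R" "a \<notin> I" "b \<notin> I"
  shows "a \<otimes> b \<notin> I"
  using assms I_prime by blast

lemma (in primeideal) pow_notin:
  assumes "a \<in> carrier R" "a \<notin> I"
  shows "a [^] (k::nat) \<notin> I"
  by (induction k) (use assms one_notin mult_notin in auto)

lemma (in primeideal) pow_mult_cancel:
  assumes "a [^] (k::nat) \<otimes> b \<in> I" "a \<in> carrier R" "a \<notin> I" "b \<in> carrier R"
  shows "b \<in> I"
  using assms pow_notin I_prime nat_pow_closed by blast

section \<open>Loci of primes and their minimal members\<close>

definition prime_locus :: "('a, 'm) ring_scheme \<Rightarrow> 'a \<Rightarrow> 'a set \<Rightarrow> 'a set set"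
  where "prime_locus A a F = {Q. primeideal Q A \<and> F \<subseteq> Q \<and> a \<notin> Q}"

definition minimal_members :: "'a set set \<Rightarrow> 'a set set"
  where "minimal_members S = {P \<in> S. \<forall>Q\<in>S. Q \<subseteq> P \<longrightarrow> Q = P}"

lemma minimal_members_Un_subset:
  assumes "S \<subseteq> T \<union> U" "T \<subseteq> S" "U \<subseteq> S"
  shows "minimal_members S \<subseteq> minimal_members T \<union> minimal_members U"
  using assms by (auto simp: minimal_members_def)

lemma prime_locus_one: "prime_locus A \<one>\<^bsub>A\<^esub> F = {Q. primeideal Q A \<and> F \<subseteq> Q}"
  by (auto simp: prime_locus_def dest: primeideal.one_notin)

text \<open>\<open>prime_locus A a F\<close> is the part of the closed set \<open>V(F)\<close>
  inside the basic open set \<open>D(a)\<close>. A prime contained in one that avoids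
  \<open>a\<close> avoids \<open>a\<close> as well, so restricting to \<open>D(a)\<close> creates no
  new minimal members.\<close>

lemma minimal_members_prime_locus_subset:
  "minimal_members (prime_locus A a F) \<subseteq> minimal_members (prime_locus A \<one>\<^bsub>A\<^esub> F)"
  unfolding prime_locus_one by (auto simp: minimal_members_def prime_locus_def)

lemma fgfc_ring_iff:
  assumes "cring A"
  shows "fgfc_ring A \<longleftrightarrow>
    (\<forall>F. finite F \<and> F \<subseteq> carrier A \<longrightarrow> finite (minimal_members (prime_locus A \<one>\<^bsub>A\<^esub> F)))"
proof -
  interpret cring A by fact
  have "minimal_primes_over A (Idl\<^bsub>A\<^esub> F) = minimal_members (prime_locus A \<one>\<^bsub>A\<^esub> F)"
    if F: "F \<subseteq> carrier A" for F
  proof -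
    have "Idl\<^bsub>A\<^esub> F \<subseteq> Q \<longleftrightarrow> F \<subseteq> Q" if "primeideal Q A" for Q
      by (rule Idl_subset_ideal[OF primeideal.axioms(1)[OF that] F])
    then show ?thesis
      by (simp add: minimal_primes_over_def minimal_members_def prime_locus_one imp_conjL cong: conj_cong)
  qed
  then show ?thesis using assms by (auto simp: fgfc_ring_def)
qed

section \<open>Contraction and extension of primes along a homomorphism\<close>

definition contraction :: "('a, 'm) ring_scheme \<Rightarrow> ('a \<Rightarrow> 'b) \<Rightarrow> 'b set \<Rightarrow> 'a set"
  where "contraction A h Q = {x \<in> carrier A. h x \<in> Q}"

lemma mem_contraction_iff: "x \<in> contraction A h Q \<longleftrightarrow> x \<in> carrier A \<and> h x \<in> Q"
  by (simp add: contraction_def)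

lemma (in ring_hom_cring) ideal_contraction:
  assumes "ideal Q S"
  shows "ideal (contraction R h Q) R"
proof -
  interpret Q: ideal Q S by fact
  show ?thesis
    by (rule R.ideal_criterion) (auto simp: contraction_def intro: Q.I_l_closed)
qed

lemma (in ring_hom_cring) primeideal_contraction:
  assumes "primeideal Q S"
  shows "primeideal (contraction R h Q) R"
proof -
  interpret Q: primeideal Q S by fact
  show ?thesis
  proof (rule primeidealI)
    show "ideal (contraction R h Q) R"
      by (rule ideal_contraction) (rule Q.is_ideal)
    show "carrier R \<noteq> contraction R h Q"
      using Q.one_notin hom_one R.one_closed unfolding contraction_def by force
    show "a \<in> contraction R h Q \<or> b \<in> contraction R h Q"
      if "a \<in> carrier R" "b \<in> carrier R" "a \<otimes> b \<in> contraction R h Q" for a b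
      using that Q.I_prime[of "h a" "h b"] by (auto simp: contraction_def)
  qed (rule R.is_cring)
qed

text \<open>The extension \<open>E\<close> of \<open>P\<close> is described by its universal property instead of as the ideal
  generated by \<open>h ` P\<close>.\<close>

definition extends_primes ::
    "('a, 'm) ring_scheme \<Rightarrow> ('b, 'n) ring_scheme \<Rightarrow> ('a \<Rightarrow> 'b) \<Rightarrow> bool"
  where "extends_primes A B h \<longleftrightarrow> ring_hom_cring A B h \<and>
    (\<forall>P. primeideal P A \<longrightarrow> (\<exists>E. primeideal E B \<and> contraction A h E = P \<and>
      (\<forall>Q. ideal Q B \<and> h ` P \<subseteq> Q \<longrightarrow> E \<subseteq> Q)))"

lemma extends_primesE:
  assumes "extends_primes A B h" "primeideal P A"
  obtains E where "primeideal E B" "contraction A h E = P"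
    "\<And>Q. ideal Q B \<Longrightarrow> h ` P \<subseteq> Q \<Longrightarrow> E \<subseteq> Q"
  using assms by (auto simp: extends_primes_def)

text \<open>The composite is a separate map \<open>k\<close> that agrees with it on the carrier
  only. In the application \<open>k\<close> is \<open>id\<close>, while the composite is an
  evaluation after the embedding of constants, which is the identity only there.\<close>

lemma extends_primes_comp:
  assumes AB: "extends_primes A B h" and BC: "extends_primes B C g"
    and k: "ring_hom_cring A C k" "\<And>x. x \<in> carrier A \<Longrightarrow> k x = g (h x)"
  shows "extends_primes A C k"
  unfolding extends_primes_def
proof (intro conjI allI impI k(1))
  interpret h: ring_hom_cring A B h using AB by (simp add: extends_primes_def)
  interpret g: ring_hom_cring B C g using BC by (simp add: extends_primes_def)
  fix P assume P: "primeideal P A"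
  then obtain E where E: "primeideal E B" "contraction A h E = P"
    "\<And>Q. ideal Q B \<Longrightarrow> h ` P \<subseteq> Q \<Longrightarrow> E \<subseteq> Q"
    using extends_primesE[OF AB] by metis
  from E(1) obtain D where D: "primeideal D C" "contraction B g D = E"
    "\<And>Q. ideal Q C \<Longrightarrow> g ` E \<subseteq> Q \<Longrightarrow> D \<subseteq> Q"
    using extends_primesE[OF BC] by metis
  have "contraction A k D = P"
    unfolding E(2)[symmetric] D(2)[symmetric] using k(2) by (auto simp: contraction_def)
  \<comment> \<open>Leastness is used twice: contracting \<open>Q\<close> to \<open>B\<close> gives
    an ideal that contains \<open>E\<close>, and then \<open>Q\<close> contains
    \<open>D\<close>.\<close>
  moreover have "D \<subseteq> Q" if Q: "ideal Q C" "k ` P \<subseteq> Q" for Q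
  proof (rule D(3)[OF Q(1)])
    have PA: "P \<subseteq> carrier A" using E(2) by (auto simp: contraction_def)
    have "ideal (contraction B g Q) B"
      using Q(1) by (rule g.ideal_contraction)
    moreover have "h ` P \<subseteq> contraction B g Q"
      using Q(2) PA k(2) by (auto simp: contraction_def subset_iff image_subset_iff)
    ultimately have "E \<subseteq> contraction B g Q" by (rule E(3))
    then show "g ` E \<subseteq> Q" by (auto simp: contraction_def)
  qed
  ultimately show "\<exists>E. primeideal E C \<and> contraction A k E = P \<and>
      (\<forall>Q. ideal Q C \<and> k ` P \<subseteq> Q \<longrightarrow> E \<subseteq> Q)"
    using D(1) by blast
qed

text \<open>Under an isomorphism the image of \<open>P\<close> is already an ideal, so it is the
  extension.\<close>

lemma extends_primes_iso:
  assumes h: "ring_hom_cring A B h" and bij: "bij_betw h (carrier A) (carrier B)"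
  shows "extends_primes A B h"
  unfolding extends_primes_def
proof (intro conjI allI impI h)
  interpret h: ring_hom_cring A B h by (rule h)
  fix P assume "primeideal P A"
  then interpret P: primeideal P A .
  have P: "P \<subseteq> carrier A" by (rule P.a_subset)
  have inj: "x \<in> P" if "h x \<in> h ` P" "x \<in> carrier A" for x
    using inj_on_image_mem_iff[OF bij_betw_imp_inj_on[OF bij]] that P by simp
  have surj: "\<exists>x \<in> carrier A. b = h x" if "b \<in> carrier B" for b
    using that bij_betw_imp_surj_on[OF bij] by auto
  have "primeideal (h ` P) B"
  proof (rule primeidealI)
    show "ideal (h ` P) B"
    proof (rule h.S.ideal_criterion)
      show "h ` P \<subseteq> carrier B" using P by (auto simp: subset_iff)
      show "\<zero>\<^bsub>B\<^esub> \<in> h ` P" using imageI[OF P.zero_closed, of h] by simp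
      fix a assume "a \<in> h ` P"
      then obtain x where x: "x \<in> P" "a = h x" by blast
      show "a \<oplus>\<^bsub>B\<^esub> b \<in> h ` P" if "b \<in> h ` P" for b
      proof -
        from that obtain y where y: "y \<in> P" "b = h y" by blast
        then have "a \<oplus>\<^bsub>B\<^esub> b = h (x \<oplus>\<^bsub>A\<^esub> y)" using x P by (simp add: subset_iff)
        then show ?thesis using imageI[OF P.a_closed[OF x(1) y(1)], of h] by metis
      qed
      show "b \<otimes>\<^bsub>B\<^esub> a \<in> h ` P" if b: "b \<in> carrier B" for b
      proof -
        obtain y where y: "y \<in> carrier A" "b = h y" using surj[OF b] by blast
        then have "b \<otimes>\<^bsub>B\<^esub> a = h (y \<otimes>\<^bsub>A\<^esub> x)" using x P by (simp add: subset_iff)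
        then show ?thesis using imageI[OF P.I_l_closed[OF x(1) y(1)], of h] by metis
      qed
    qed
    show "carrier B \<noteq> h ` P"
      using inj[of "\<one>\<^bsub>A\<^esub>"] P.one_notin h.S.one_closed by auto
    fix a b assume ab: "a \<in> carrier B" "b \<in> carrier B" "a \<otimes>\<^bsub>B\<^esub> b \<in> h ` P"
    then obtain x y where xy: "x \<in> carrier A" "y \<in> carrier A" "a = h x" "b = h y"
      using surj by metis
    then have "x \<otimes>\<^bsub>A\<^esub> y \<in> P" using ab(3) by (intro inj) auto
    then have "x \<in> P \<or> y \<in> P" by (rule P.I_prime[OF xy(1,2)])
    then show "a \<in> h ` P \<or> b \<in> h ` P" using xy(3,4) by auto
  qed (rule h.S.is_cring)
  moreover have "contraction A h (h ` P) = P"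
  proof (rule Set.set_eqI)
    show "x \<in> contraction A h (h ` P) \<longleftrightarrow> x \<in> P" for x
      using inj[of x] by (auto simp: contraction_def)
  qed
  ultimately show "\<exists>E. primeideal E B \<and> contraction A h E = P \<and>
      (\<forall>Q. ideal Q B \<and> h ` P \<subseteq> Q \<longrightarrow> E \<subseteq> Q)" by blast
qed

text \<open>If \<open>Q\<close> is minimal over the image of \<open>F\<close> and \<open>P\<close>
  is a prime with \<open>F \<subseteq> P\<close> inside the contraction of \<open>Q\<close>, then
  the extension of \<open>P\<close> is a prime between them and must be \<open>Q\<close>
  (\<open>E_eq\<close>). Hence \<open>P\<close> equals the contraction, which is therefore minimal
  over \<open>F\<close>; and for \<open>P\<close> the contraction itself, \<open>Q\<close> is
  recovered from it, so contraction is injective on these primes.\<close>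

lemma finite_minimal_members_extension:
  assumes h: "extends_primes A B h" and F: "F \<subseteq> carrier A"
    and fin: "finite (minimal_members (prime_locus A \<one>\<^bsub>A\<^esub> F))"
  shows "finite (minimal_members (prime_locus B \<one>\<^bsub>B\<^esub> (h ` F)))"
proof -
  let ?M = "minimal_members (prime_locus B \<one>\<^bsub>B\<^esub> (h ` F))"
  interpret h: ring_hom_cring A B h using h by (simp add: extends_primes_def)
  have mem: "primeideal Q B" "h ` F \<subseteq> Q" "primeideal (contraction A h Q) A"
    "F \<subseteq> contraction A h Q" if "Q \<in> ?M" for Q
    using that h.primeideal_contraction F
    by (auto simp: minimal_members_def prime_locus_def contraction_def)
  have E_eq: "E = Q"
    if Q: "Q \<in> ?M" and E: "primeideal E B" "contraction A h E = P"
      "\<And>Q. ideal Q B \<Longrightarrow> h ` P \<subseteq> Q \<Longrightarrow> E \<subseteq> Q"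
      and P: "F \<subseteq> P" "P \<subseteq> contraction A h Q" for E P Q
  proof -
    have "E \<subseteq> Q"
      using P(2) mem(1)[OF Q] by (intro E(3) primeideal.axioms(1)) (auto simp: contraction_def)
    moreover have "h ` F \<subseteq> E" using P(1) E(2) by (auto simp: contraction_def)
    ultimately show ?thesis
      using Q E(1) by (auto simp: minimal_members_def prime_locus_one)
  qed
  have "contraction A h ` ?M \<subseteq> minimal_members (prime_locus A \<one>\<^bsub>A\<^esub> F)"
  proof (rule image_subsetI)
    fix Q assume Q: "Q \<in> ?M"
    have "P = contraction A h Q"
      if P: "primeideal P A" "F \<subseteq> P" "P \<subseteq> contraction A h Q" for P
      using extends_primesE[OF h P(1)] E_eq[OF Q _ _ _ P(2,3)] by metis
    then show "contraction A h Q \<in> minimal_members (prime_locus A \<one>\<^bsub>A\<^esub> F)"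
      using mem(3,4)[OF Q] by (auto simp: minimal_members_def prime_locus_one)
  qed
  moreover have "inj_on (contraction A h) ?M"
  proof (rule inj_onI)
    fix Q Q' assume Q: "Q \<in> ?M" "Q' \<in> ?M" and eq: "contraction A h Q = contraction A h Q'"
    obtain E where E: "primeideal E B" "contraction A h E = contraction A h Q"
      "\<And>Q'. ideal Q' B \<Longrightarrow> h ` contraction A h Q \<subseteq> Q' \<Longrightarrow> E \<subseteq> Q'"
      using extends_primesE[OF h mem(3)[OF Q(1)]] by metis
    have "E = Q" by (rule E_eq[OF Q(1) E mem(4)[OF Q(1)] subset_refl])
    moreover have "E = Q'" by (rule E_eq[OF Q(2) E mem(4)[OF Q(1)] equalityD1[OF eq]])
    ultimately show "Q = Q'" by simp
  qed
  ultimately show ?thesis using fin by (meson finite_imageD finite_subset)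
qed

lemma fgfc_ring_iso:
  assumes A: "fgfc_ring A" and h: "ring_hom_cring A B h"
    and bij: "bij_betw h (carrier A) (carrier B)"
  shows "fgfc_ring B"
proof -
  interpret h: ring_hom_cring A B h by (rule h)
  have "finite (minimal_members (prime_locus B \<one>\<^bsub>B\<^esub> F))" if F: "finite F" "F \<subseteq> carrier B" for F
  proof -
    have "F \<subseteq> h ` carrier A" using F(2) bij_betw_imp_surj_on[OF bij] by simp
    then obtain G where G: "G \<subseteq> carrier A" "finite G" "F = h ` G"
      using finite_subset_image[OF F(1)] by blast
    have "finite (minimal_members (prime_locus A \<one>\<^bsub>A\<^esub> G))"
      using A G(1,2) fgfc_ring_iff[OF h.R.is_cring] by blast
    then show ?thesis
      unfolding G(3) by (rule finite_minimal_members_extension[OF extends_primes_iso[OF h bij] G(1)])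
  qed
  then show ?thesis using fgfc_ring_iff[OF h.S.is_cring] by blast
qed

section \<open>Primes of a polynomial ring in one variable\<close>

lemma (in ideal) finsum_mem:
  assumes "finite A" "f \<in> A \<rightarrow> I"
  shows "finsum R f A \<in> I"
  using assms
proof (induction A rule: finite_induct)
  case (insert x A)
  then have "f \<in> A \<rightarrow> carrier R" "f x \<in> carrier R" using Icarr by (auto simp: Pi_iff)
  then show ?case using insert by (auto simp: finsum_insert)
qed simp

text \<open>The extended ideal \<open>L[x]\<close>, given by its coefficients. It is the kernel of
  the reduction to polynomials over \<open>R/L\<close>, so membership in it stands for vanishing
  modulo \<open>L\<close>.\<close>

definition UP_ideal :: "('a, 'm) ring_scheme \<Rightarrow> 'a set \<Rightarrow> (nat \<Rightarrow> 'a) set"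
  where "UP_ideal R L = {p \<in> carrier (UP R). \<forall>i. up_ring.coeff (UP R) p i \<in> L}"

context UP_cring
begin

text \<open>The list-based polynomials of \<^theory>\<open>HOL-Algebra.Polynomials\<close> have a \<open>coeff\<close> and a \<open>monom\<close>
  that shadow those of \<^theory>\<open>HOL-Algebra.UnivPoly\<close>.\<close>

abbreviation cf :: "(nat \<Rightarrow> 'a) \<Rightarrow> nat \<Rightarrow> 'a"
  where "cf \<equiv> up_ring.coeff P"

abbreviation mon :: "'a \<Rightarrow> nat \<Rightarrow> nat \<Rightarrow> 'a"
  where "mon \<equiv> up_ring.monom P"

abbreviation const :: "'a \<Rightarrow> nat \<Rightarrow> 'a"
  where "const a \<equiv> mon a 0"

lemma UP_ideal_iff: "p \<in> UP_ideal R L \<longleftrightarrow> p \<in> carrier P \<and> (\<forall>i. cf p i \<in> L)"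
  by (simp add: UP_ideal_def P_def)

lemma const_hom: "ring_hom_cring R P const"
  by (rule ring_hom_cringI[OF R.is_cring UP_cring const_ring_hom])

lemma coeff_const_mult:
  assumes "a \<in> carrier R" "p \<in> carrier P"
  shows "cf (const a \<otimes>\<^bsub>P\<^esub> p) i = a \<otimes> cf p i"
  using assms by (simp add: monom_mult_is_smult)

lemma UP_ideal_ideal:
  assumes "ideal L R"
  shows "ideal (UP_ideal R L) P"
proof -
  interpret L: ideal L R by fact
  show ?thesis
  proof (rule P.ideal_criterion)
    fix p q assume p: "p \<in> UP_ideal R L" and q: "q \<in> carrier P"
    have "(\<Oplus>i\<in>{..n}. cf q i \<otimes> cf p (n - i)) \<in> L" for n
      using p q by (intro L.finsum_mem) (auto simp: UP_ideal_iff intro: L.I_l_closed)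
    then show "q \<otimes>\<^bsub>P\<^esub> p \<in> UP_ideal R L" using p q by (simp add: UP_ideal_iff)
  qed (auto simp: UP_ideal_iff)
qed

lemma const_mem_UP_ideal_iff:
  assumes "ideal L R" "a \<in> carrier R"
  shows "const a \<in> UP_ideal R L \<longleftrightarrow> a \<in> L"
proof -
  interpret L: ideal L R by fact
  show ?thesis using assms(2) by (auto simp: UP_ideal_iff)
qed

text \<open>Each monomial of \<open>p\<close> is a constant from \<open>L\<close> times a power of
  the variable.\<close>

lemma UP_ideal_least:
  assumes "ideal Q P" "const ` L \<subseteq> Q" "L \<subseteq> carrier R"
  shows "UP_ideal R L \<subseteq> Q"
proof
  fix p assume p: "p \<in> UP_ideal R L"
  interpret Q: ideal Q P by fact
  have pc: "p \<in> carrier P" and pL: "cf p i \<in> L" for i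
    using p by (auto simp: UP_ideal_iff)
  have "mon (cf p i) i \<in> Q" for i
  proof -
    have "const (cf p i) \<otimes>\<^bsub>P\<^esub> mon \<one> i \<in> Q"
      using pL[of i] assms(2) by (intro Q.I_r_closed) auto
    also have "const (cf p i) \<otimes>\<^bsub>P\<^esub> mon \<one> i = mon (cf p i) i"
      using monom_mult[of "cf p i" \<one> 0 i] pc by simp
    finally show ?thesis .
  qed
  then have "(\<Oplus>\<^bsub>P\<^esub>i\<in>{..deg R p}. mon (cf p i) i) \<in> Q"
    by (intro Q.finsum_mem) auto
  then show "p \<in> Q" by (simp add: up_repr[OF pc])
qed

text \<open>Every summand of the coefficient at \<open>n + m\<close>, except the one at
  \<open>n\<close>, has a factor beyond position \<open>n\<close> in \<open>p\<close> or beyond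
  position \<open>m\<close> in \<open>q\<close>, and this factor lies in \<open>L\<close>. The
  positions bound the degrees modulo \<open>L\<close>, not the actual degrees.\<close>

lemma coeff_mult_top:
  assumes "ideal L R" and p: "p \<in> carrier P" "\<forall>i>n. cf p i \<in> L"
    and q: "q \<in> carrier P" "\<forall>i>m. cf q i \<in> L"
  shows "\<exists>s\<in>L. cf (p \<otimes>\<^bsub>P\<^esub> q) (n + m) = (cf p n \<otimes> cf q m) \<oplus> s"
proof -
  interpret L: ideal L R by fact
  let ?f = "\<lambda>i. cf p i \<otimes> cf q (n + m - i)"
  have "?f i \<in> L" if "i \<noteq> n" for i
  proof (cases "i < n")
    case True
    then show ?thesis using p(1) q by (intro L.I_l_closed) auto
  next
    case False
    then show ?thesis using that p q(1) by (intro L.I_r_closed) auto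
  qed
  then have "finsum R ?f ({..n + m} - {n}) \<in> L" by (intro L.finsum_mem) auto
  moreover have "cf (p \<otimes>\<^bsub>P\<^esub> q) (n + m) = finsum R ?f (insert n ({..n + m} - {n}))"
    using p q by (simp add: insert_absorb)
  then have "cf (p \<otimes>\<^bsub>P\<^esub> q) (n + m) =
      (cf p n \<otimes> cf q m) \<oplus> finsum R ?f ({..n + m} - {n})"
    using p(1) q(1) by (subst (asm) R.finsum_insert) auto
  ultimately show ?thesis by blast
qed

lemma top_coeff_notin:
  assumes "ideal L R" "p \<in> carrier P" "p \<notin> UP_ideal R L"
  obtains n where "cf p n \<notin> L" "\<forall>i>n. cf p i \<in> L"
proof -
  interpret L: ideal L R by fact
  let ?A = "{i. cf p i \<notin> L}"
  have "i \<le> deg R p" if "i \<in> ?A" for i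
    using that assms(2) deg_aboveD[of p i] by (auto simp: not_less[symmetric])
  then have fin: "finite ?A" by (meson finite_nat_set_iff_bounded_le)
  have "?A \<noteq> {}" using assms(2,3) by (auto simp: UP_ideal_iff)
  with fin have "Max ?A \<in> ?A" by (rule Max_in)
  then have notin: "cf p (Max ?A) \<notin> L" by simp
  have "\<forall>i>Max ?A. cf p i \<in> L"
    using Max_ge[OF fin] by (meson leD mem_Collect_eq)
  then show thesis by (rule that[OF notin])
qed

text \<open>A polynomial whose leading coefficient \<open>c\<close> modulo \<open>L\<close> is
  inverted is not a zero divisor: if \<open>f h\<close> vanishes modulo \<open>L\<close>, then
  \<open>c\<close> kills the top coefficient of \<open>h\<close>, so \<open>c h\<close> has smaller
  degree modulo \<open>L\<close>, and iteration kills \<open>h\<close>. Here \<open>L\<close> is an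
  arbitrary ideal, since going down applies this to a sum \<open>L + d R\<close> that need not be
  prime.\<close>

lemma const_pow_mult_mem:
  assumes L: "ideal L R" and f: "f \<in> carrier P" "\<forall>i>n. cf f i \<in> L"
    and h: "h \<in> carrier P" "f \<otimes>\<^bsub>P\<^esub> h \<in> UP_ideal R L"
  shows "\<exists>k::nat. const (cf f n [^] k) \<otimes>\<^bsub>P\<^esub> h \<in> UP_ideal R L"
proof -
  interpret L: ideal L R by fact
  interpret U: ideal "UP_ideal R L" P by (rule UP_ideal_ideal[OF L])
  let ?c = "cf f n"
  have c: "?c \<in> carrier R" using f(1) by simp
  \<comment> \<open>The induction is on a bound \<open>m\<close> for the exponents at which
    \<open>h\<close> may be nonzero modulo \<open>L\<close>; \<open>h\<close> is generalized because
    the induction hypothesis is applied to \<open>c h\<close>.\<close>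
  have step: "\<exists>k::nat. const (?c [^] k) \<otimes>\<^bsub>P\<^esub> h \<in> UP_ideal R L"
    if "h \<in> carrier P" "f \<otimes>\<^bsub>P\<^esub> h \<in> UP_ideal R L" "\<forall>i\<ge>m. cf h i \<in> L" for m h
    using that
  proof (induction m arbitrary: h)
    case 0
    then have "const (?c [^] (0::nat)) \<otimes>\<^bsub>P\<^esub> h \<in> UP_ideal R L"
      by (simp add: UP_ideal_iff)
    then show ?case by blast
  next
    case (Suc m)
    note h = Suc.prems
    let ?h = "const ?c \<otimes>\<^bsub>P\<^esub> h"
    have hm: "\<forall>i>m. cf h i \<in> L" using h(3) by simp
    obtain s where s: "s \<in> L" "cf (f \<otimes>\<^bsub>P\<^esub> h) (n + m) = (?c \<otimes> cf h m) \<oplus> s"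
      using coeff_mult_top[OF L f h(1) hm] by (rule bexE)
    have "cf (f \<otimes>\<^bsub>P\<^esub> h) (n + m) \<in> L" using h(2) by (simp only: UP_ideal_iff)
    then have "(?c \<otimes> cf h m) \<oplus> s \<in> L" by (simp only: s(2))
    then have cm: "?c \<otimes> cf h m \<in> L"
      by (rule L.mem_diff_cancel) (use s(1) c h(1) in auto)
    have "\<exists>k::nat. const (?c [^] k) \<otimes>\<^bsub>P\<^esub> ?h \<in> UP_ideal R L"
    proof (rule Suc.IH)
      show "?h \<in> carrier P" using c h(1) by simp
      have "f \<otimes>\<^bsub>P\<^esub> ?h = const ?c \<otimes>\<^bsub>P\<^esub> (f \<otimes>\<^bsub>P\<^esub> h)"
        using f(1) c h(1) by (intro P.m_lcomm) auto
      then show "f \<otimes>\<^bsub>P\<^esub> ?h \<in> UP_ideal R L"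
        using U.I_l_closed[OF h(2), of "const ?c"] c by simp
      show "\<forall>i\<ge>m. cf ?h i \<in> L"
      proof (intro allI impI)
        fix i assume "m \<le> i"
        show "cf ?h i \<in> L"
        proof (cases "i = m")
          case True
          then show ?thesis using cm c h(1) by (simp only: coeff_const_mult)
        next
          case False
          then have "cf h i \<in> L" using \<open>m \<le> i\<close> h(3) by simp
          then show ?thesis using c h(1) by (simp only: coeff_const_mult L.I_l_closed)
        qed
      qed
    qed
    then obtain k :: nat where k: "const (?c [^] k) \<otimes>\<^bsub>P\<^esub> ?h \<in> UP_ideal R L" ..
    have "const (?c [^] k) \<otimes>\<^bsub>P\<^esub> ?h = (const (?c [^] k) \<otimes>\<^bsub>P\<^esub> const ?c) \<otimes>\<^bsub>P\<^esub> h"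
      using c h(1) by (intro P.m_assoc[symmetric]) auto
    also have "const (?c [^] k) \<otimes>\<^bsub>P\<^esub> const ?c = const (?c [^] Suc k)"
      using monom_mult[of "?c [^] k" ?c 0 0] c by simp
    finally show ?case using k by metis
  qed
  have "\<forall>i\<ge>Suc (deg R h). cf h i \<in> L"
    using h(1) deg_aboveD[of h] by simp
  then show ?thesis by (rule step[OF h])
qed

text \<open>If \<open>f\<close> is outside \<open>L[x]\<close>, its top coefficient outside
  \<open>L\<close> has a power that carries every coefficient of \<open>h\<close> into
  \<open>L\<close>; since \<open>L\<close> is prime, that power cancels.\<close>

lemma UP_ideal_primeideal:
  assumes "primeideal L R"
  shows "primeideal (UP_ideal R L) P"
proof -
  interpret L: primeideal L R by fact
  note U = UP_ideal_ideal[OF L.is_ideal]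
  show ?thesis
  proof (rule primeidealI[OF U UP_cring])
    have "\<one>\<^bsub>P\<^esub> \<notin> UP_ideal R L" using L.one_notin by (auto simp: UP_ideal_iff)
    then show "carrier P \<noteq> UP_ideal R L" using P.one_closed by metis
    fix f h assume fh: "f \<in> carrier P" "h \<in> carrier P" "f \<otimes>\<^bsub>P\<^esub> h \<in> UP_ideal R L"
    have "h \<in> UP_ideal R L" if "f \<notin> UP_ideal R L"
    proof -
      from that obtain n where n: "cf f n \<notin> L" "\<forall>i>n. cf f i \<in> L"
        using top_coeff_notin[OF L.is_ideal fh(1)] by metis
      obtain k :: nat where "const (cf f n [^] k) \<otimes>\<^bsub>P\<^esub> h \<in> UP_ideal R L"
        using const_pow_mult_mem[OF L.is_ideal fh(1) n(2) fh(2,3)] by metis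
      then have "cf f n [^] k \<otimes> cf h i \<in> L" for i
        using fh(1,2) by (simp add: UP_ideal_iff coeff_const_mult del: coeff_mult)
      then have "cf h i \<in> L" for i
        using L.pow_mult_cancel n(1) fh(1,2) coeff_closed by metis
      then show "h \<in> UP_ideal R L" using fh(2) by (simp add: UP_ideal_iff)
    qed
    then show "f \<in> UP_ideal R L \<or> h \<in> UP_ideal R L" by blast
  qed
qed

lemma extends_primes_const: "extends_primes R P const"
  unfolding extends_primes_def
proof (intro conjI allI impI const_hom)
  fix L assume "primeideal L R"
  then interpret L: primeideal L R .
  have "contraction R const (UP_ideal R L) = L"
    using L.a_subset by (auto simp: contraction_def const_mem_UP_ideal_iff[OF L.is_ideal])
  then show "\<exists>E. primeideal E P \<and> contraction R const E = L \<and>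
      (\<forall>Q. ideal Q P \<and> const ` L \<subseteq> Q \<longrightarrow> E \<subseteq> Q)"
    using UP_ideal_primeideal[OF L.primeideal] UP_ideal_least[OF _ _ L.a_subset]
    by (intro exI[of _ "UP_ideal R L"]) simp
qed

end

section \<open>The FGFC property of a polynomial ring in one variable\<close>

text \<open>The ideal \<open>f A + I\<close>, written by its elements because the going-down
  computation needs the cofactor \<open>h\<close> and not just membership.\<close>

definition principal_plus :: "('a, 'm) ring_scheme \<Rightarrow> 'a \<Rightarrow> 'a set \<Rightarrow> 'a set"
  where "principal_plus A f I = (\<lambda>(h, p). (f \<otimes>\<^bsub>A\<^esub> h) \<oplus>\<^bsub>A\<^esub> p) ` (carrier A \<times> I)"

lemma principal_plusI:
  "h \<in> carrier A \<Longrightarrow> p \<in> I \<Longrightarrow> (f \<otimes>\<^bsub>A\<^esub> h) \<oplus>\<^bsub>A\<^esub> p \<in> principal_plus A f I"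
  unfolding principal_plus_def by (rule image_eqI[of _ _ "(h, p)"]) auto

lemma principal_plusE:
  assumes "x \<in> principal_plus A f I"
  obtains h p where "h \<in> carrier A" "p \<in> I" "x = (f \<otimes>\<^bsub>A\<^esub> h) \<oplus>\<^bsub>A\<^esub> p"
  using assms by (auto simp: principal_plus_def)

lemma (in cring) principal_plus_ideal:
  assumes "ideal I R" and f: "f \<in> carrier R"
  shows "ideal (principal_plus R f I) R"
proof -
  interpret I: ideal I R by fact
  show ?thesis
  proof (rule ideal_criterion)
    show "principal_plus R f I \<subseteq> carrier R"
      using f I.Icarr by (auto elim!: principal_plusE)
    show "\<zero> \<in> principal_plus R f I"
      using principal_plusI[OF zero_closed I.zero_closed, of f] f by simp
    fix a assume "a \<in> principal_plus R f I"
    then obtain h p where hp: "h \<in> carrier R" "p \<in> I" "a = (f \<otimes> h) \<oplus> p"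
      by (rule principal_plusE)
    show "a \<oplus> b \<in> principal_plus R f I" if "b \<in> principal_plus R f I" for b
    proof -
      from that obtain h' p' where hp': "h' \<in> carrier R" "p' \<in> I"
        "b = (f \<otimes> h') \<oplus> p'" by (rule principal_plusE)
      have "a \<oplus> b = (f \<otimes> (h \<oplus> h')) \<oplus> (p \<oplus> p')"
        unfolding hp(3) hp'(3) using f hp(1) hp'(1) I.Icarr[OF hp(2)] I.Icarr[OF hp'(2)]
        by (simp add: r_distr a_ac)
      then show ?thesis
        using principal_plusI[OF a_closed[OF hp(1) hp'(1)] I.a_closed[OF hp(2) hp'(2)], of f]
        by simp
    qed
    show "b \<otimes> a \<in> principal_plus R f I" if b: "b \<in> carrier R" for b
    proof -
      have "b \<otimes> a = (f \<otimes> (b \<otimes> h)) \<oplus> (b \<otimes> p)"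
        unfolding hp(3) using f hp(1) I.Icarr[OF hp(2)] b by (simp add: r_distr m_lcomm)
      then show ?thesis
        using principal_plusI[OF m_closed[OF b hp(1)] I.I_l_closed[OF hp(2) b], of f] by simp
    qed
  qed
qed

lemma (in cring) principal_plus_contains:
  assumes "ideal I R" and f: "f \<in> carrier R"
  shows "f \<in> principal_plus R f I" and "I \<subseteq> principal_plus R f I"
proof -
  interpret I: ideal I R by fact
  show "f \<in> principal_plus R f I"
    using principal_plusI[OF one_closed I.zero_closed, of f] f by simp
  show "I \<subseteq> principal_plus R f I"
  proof
    fix p assume p: "p \<in> I"
    show "p \<in> principal_plus R f I"
      using principal_plusI[OF zero_closed p, of f] f I.Icarr[OF p] by simp
  qed
qed

context UP_cring
begin

text \<open>Over the residue field of \<open>L\<close>, a member \<open>N\<close> of the fibre is generated by an element \<open>g \<in> N\<close>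
  of least degree, and \<open>f\<close> factors as \<open>g q\<close> with \<open>q\<close> of smaller degree. Every other member that is
  minimal therefore contains \<open>q\<close>.\<close>

lemma finite_minimal_fibre:
  assumes L: "primeideal L R"
    and f: "f \<in> carrier P" "cf f n \<notin> L" "\<forall>i>n. cf f i \<in> L"
  shows "finite (minimal_members {Q. primeideal Q P \<and> contraction R const Q = L \<and> f \<in> Q})"
  using f
proof (induction n arbitrary: f rule: less_induct)
  case (less n)
  interpret L: primeideal L R by fact
  interpret U: primeideal "UP_ideal R L" P by (rule UP_ideal_primeideal[OF L])
  let ?T = "\<lambda>f. {Q. primeideal Q P \<and> contraction R const Q = L \<and> f \<in> Q}"
  show ?case
  proof (cases "?T f = {}")
    case True
    then show ?thesis by (simp only: True minimal_members_def) simp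
  next
    case False
    then obtain N where N: "N \<in> ?T f" by blast
    interpret N: primeideal N P using N by blast
    have U_subset: "UP_ideal R L \<subseteq> Q" if "Q \<in> ?T h" for Q h
    proof (rule UP_ideal_least)
      show "ideal Q P" using that primeideal.axioms(1)[of Q P] by simp
      show "const ` L \<subseteq> Q" using that by (auto simp: contraction_def)
    qed (rule L.a_subset)
    have const_iff: "const a \<in> Q \<longleftrightarrow> a \<in> L" if "Q \<in> ?T h" "a \<in> carrier R" for Q h a
      using that by (auto simp: contraction_def)
    have f_notin: "f \<notin> UP_ideal R L" using less.prems by (auto simp: UP_ideal_iff)
    have "f \<in> N \<and> f \<notin> UP_ideal R L" using N f_notin by blast
    then obtain g where g: "g \<in> N" "g \<notin> UP_ideal R L"
      and least: "\<forall>h. h \<in> N \<and> h \<notin> UP_ideal R L \<longrightarrow> deg R g \<le> deg R h"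
      using ex_has_least_nat[of "\<lambda>h. h \<in> N \<and> h \<notin> UP_ideal R L" f "deg R"] by blast
    have gc: "g \<in> carrier P" using g(1) N.Icarr by blast
    define d where "d = deg R g"
    define c where "c = cf g d"
    have c: "c \<in> carrier R" using gc by (simp add: c_def)
    \<comment> \<open>A constant of \<open>N\<close> lies in \<open>L\<close>, because
      \<open>N\<close> is in the fibre. That \<open>d\<close> is positive is what later makes the
      cofactor \<open>q\<close> smaller than \<open>f\<close>.\<close>
    have d0: "d \<noteq> 0"
    proof
      assume "d = 0"
      then have eq: "g = const c" using deg_zero_impl_monom[OF gc] by (simp add: d_def c_def)
      then have "c \<in> L" using const_iff[OF N c] g(1) by simp
      then show False using const_mem_UP_ideal_iff[OF L.is_ideal c] g(2) eq by simp
    qed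
    \<comment> \<open>\<open>deg R g\<close> is the actual degree, not the degree modulo
      \<open>L\<close>. They agree: if the leading coefficient were in \<open>L\<close>, removing
      the leading monomial would leave an element of \<open>N\<close> outside \<open>L[x]\<close> of
      smaller degree.\<close>
    have cL: "c \<notin> L"
    proof
      assume cL: "c \<in> L"
      let ?m = "mon c d"
      have mc: "?m \<in> carrier P" using c by simp
      have mU: "?m \<in> UP_ideal R L" using c cL by (simp add: UP_ideal_iff)
      let ?g = "g \<ominus>\<^bsub>P\<^esub> ?m"
      have "?g \<in> N" using N.diff_closed g(1) mU U_subset[OF N] by blast
      moreover have "?g \<notin> UP_ideal R L"
      proof
        assume "?g \<in> UP_ideal R L"
        then have "?g \<oplus>\<^bsub>P\<^esub> ?m \<in> UP_ideal R L" using mU by (rule U.a_closed)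
        also have "?g \<oplus>\<^bsub>P\<^esub> ?m = g" using gc mc by (simp add: a_minus_def P.a_assoc P.l_neg)
        finally show False using g(2) by simp
      qed
      moreover have "deg R ?g \<le> d - 1"
      proof (rule deg_aboveI)
        fix i assume i: "d - 1 < i"
        show "cf ?g i = \<zero>"
        proof (cases "i = d")
          case True
          then show ?thesis using gc mc c by (simp add: coeff_minus c_def)
        next
          case False
          then show ?thesis using i gc mc c deg_aboveD[of g i] by (simp add: coeff_minus d_def)
        qed
      qed (use gc mc in simp)
      ultimately have "d \<le> d - 1" using least unfolding d_def by (meson le_trans)
      then show False using d0 by simp
    qed
    have g0: "g \<noteq> \<zero>\<^bsub>P\<^esub>" using g(2) U.zero_closed by metis
    \<comment> \<open>Pseudo-division by \<open>g\<close> leaves a remainder in \<open>N\<close> of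
      degree below \<open>d\<close>, and the choice of \<open>g\<close> forces it into
      \<open>L[x]\<close>. So modulo \<open>L[x]\<close>, and up to constants outside
      \<open>L\<close>, everything in \<open>N\<close> is a multiple of \<open>g\<close>.\<close>
    have division: "\<exists>q r. \<exists>k::nat. q \<in> carrier P \<and> r \<in> UP_ideal R L \<and>
        const (c [^] k) \<otimes>\<^bsub>P\<^esub> h = (g \<otimes>\<^bsub>P\<^esub> q) \<oplus>\<^bsub>P\<^esub> r" if "h \<in> N" for h
    proof -
      have hc: "h \<in> carrier P" using that N.Icarr by blast
      obtain q r and k :: nat where qr: "q \<in> carrier P" "r \<in> carrier P"
        "c [^] k \<odot>\<^bsub>P\<^esub> h = (g \<otimes>\<^bsub>P\<^esub> q) \<oplus>\<^bsub>P\<^esub> r" "r = \<zero>\<^bsub>P\<^esub> \<or> deg R r < d"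
        using long_div_theorem[OF gc hc g0] unfolding c_def d_def by metis
      have eq: "const (c [^] k) \<otimes>\<^bsub>P\<^esub> h = (g \<otimes>\<^bsub>P\<^esub> q) \<oplus>\<^bsub>P\<^esub> r"
        using qr(3) c hc by (simp add: monom_mult_is_smult)
      have "const (c [^] k) \<otimes>\<^bsub>P\<^esub> h \<in> N" using c by (intro N.I_l_closed[OF that]) simp
      then have "r \<oplus>\<^bsub>P\<^esub> (g \<otimes>\<^bsub>P\<^esub> q) \<in> N"
        unfolding eq using gc qr(1,2) by (simp add: P.a_comm)
      then have "r \<in> N" by (rule N.mem_diff_cancel) (use N.I_r_closed g(1) qr(1,2) in auto)
      moreover have "r \<in> UP_ideal R L" if "r = \<zero>\<^bsub>P\<^esub>" using that U.zero_closed by simp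
      ultimately have "r \<in> UP_ideal R L" using least qr(4) unfolding d_def by (meson leD)
      then show ?thesis using qr(1) eq by blast
    qed
    have cancel: "h \<in> Q" if "Q \<in> ?T e" "const (c [^] (k::nat)) \<otimes>\<^bsub>P\<^esub> h \<in> Q" "h \<in> carrier P"
      for Q e h k
    proof -
      interpret Q: primeideal Q P using that(1) by blast
      have "const (c [^] k) \<notin> Q" using const_iff[OF that(1)] L.pow_notin c cL by simp
      then show ?thesis using Q.I_prime[OF _ that(3,2)] c by simp
    qed
    have N_subset: "N \<subseteq> Q" if Q: "Q \<in> ?T f" "g \<in> Q" for Q
    proof
      interpret Q: primeideal Q P using Q(1) by blast
      fix h assume h: "h \<in> N"
      then obtain q r and k :: nat where qr: "q \<in> carrier P" "r \<in> UP_ideal R L"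
        "const (c [^] k) \<otimes>\<^bsub>P\<^esub> h = (g \<otimes>\<^bsub>P\<^esub> q) \<oplus>\<^bsub>P\<^esub> r"
        using division by metis
      have "r \<in> Q" using qr(2) U_subset[OF Q(1)] by blast
      then have "const (c [^] k) \<otimes>\<^bsub>P\<^esub> h \<in> Q"
        unfolding qr(3) using Q.I_r_closed[OF Q(2) qr(1)] by simp
      then show "h \<in> Q" using cancel[OF Q(1)] N.Icarr[OF h] by metis
    qed
    obtain q r and k :: nat where qr: "q \<in> carrier P" "r \<in> UP_ideal R L"
      "const (c [^] k) \<otimes>\<^bsub>P\<^esub> f = (g \<otimes>\<^bsub>P\<^esub> q) \<oplus>\<^bsub>P\<^esub> r"
      using division[of f] N by blast
    have rc: "r \<in> carrier P" using qr(2) by (simp add: UP_ideal_iff)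
    have ck: "c [^] k \<in> carrier R" "c [^] k \<notin> L" using L.pow_notin c cL by simp_all
    have q_notin: "q \<notin> UP_ideal R L"
    proof
      assume "q \<in> UP_ideal R L"
      then have "const (c [^] k) \<otimes>\<^bsub>P\<^esub> f \<in> UP_ideal R L"
        unfolding qr(3) using U.I_l_closed[OF _ gc] qr(2) by simp
      then have "const (c [^] k) \<in> UP_ideal R L"
        using U.I_prime[of "const (c [^] k)" f] f_notin less.prems(1) ck(1) by simp
      then show False using const_mem_UP_ideal_iff[OF L.is_ideal ck(1)] ck(2) by simp
    qed
    obtain e where e: "cf q e \<notin> L" "\<forall>i>e. cf q i \<in> L"
      using top_coeff_notin[OF L.is_ideal qr(1) q_notin] by metis
    \<comment> \<open>Degrees modulo \<open>L\<close> add up. If \<open>e\<close> were at least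
      \<open>n\<close>, then \<open>d + e\<close> would exceed \<open>n\<close>, so the coefficient
      of \<open>f\<close> there would be in \<open>L\<close>; but up to members of \<open>L\<close>
      and the factor \<open>c [^] k\<close> it is the product of \<open>c\<close> and
      \<open>cf q e\<close>, both outside the prime \<open>L\<close>.\<close>
    have "e < n"
    proof (rule ccontr)
      assume "\<not> e < n"
      then have "cf f (d + e) \<in> L" using d0 less.prems(3) by simp
      then have "cf (const (c [^] k) \<otimes>\<^bsub>P\<^esub> f) (d + e) \<in> L"
        using ck(1) less.prems(1) by (simp only: coeff_const_mult L.I_l_closed)
      then have "cf (g \<otimes>\<^bsub>P\<^esub> q) (d + e) \<oplus> cf r (d + e) \<in> L"
        unfolding qr(3) using gc qr(1) rc by (simp only: coeff_add UP_mult_closed)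
      moreover have "cf r (d + e) \<in> L" using qr(2) by (simp add: UP_ideal_iff)
      ultimately have gq: "cf (g \<otimes>\<^bsub>P\<^esub> q) (d + e) \<in> L"
        by (rule L.mem_diff_cancel) (intro coeff_closed UP_mult_closed gc qr(1))
      have "\<forall>i>d. cf g i \<in> L" using deg_aboveD[OF _ gc] by (simp add: d_def)
      then obtain s where s: "s \<in> L" "cf (g \<otimes>\<^bsub>P\<^esub> q) (d + e) = (c \<otimes> cf q e) \<oplus> s"
        using coeff_mult_top[OF L.is_ideal gc _ qr(1) e(2)] unfolding c_def by metis
      have "(c \<otimes> cf q e) \<oplus> s \<in> L" using gq by (simp only: s(2))
      then have "c \<otimes> cf q e \<in> L"
        by (rule L.mem_diff_cancel) (use s(1) c qr(1) in auto)
      then show False using L.mult_notin[OF c _ cL e(1)] qr(1) by simp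
    qed
    \<comment> \<open>The primes of the fibre containing \<open>g\<close> have \<open>N\<close> as
      their least member; all others contain \<open>q\<close>, to which the induction hypothesis
      applies.\<close>
    have cover: "?T f \<subseteq> {Q \<in> ?T f. g \<in> Q} \<union> ?T q"
    proof
      fix Q assume Q: "Q \<in> ?T f"
      interpret Q: primeideal Q P using Q by blast
      have "const (c [^] k) \<otimes>\<^bsub>P\<^esub> f \<in> Q" using Q.I_l_closed Q ck(1) by simp
      moreover have "r \<in> Q" using qr(2) U_subset[OF Q] by blast
      ultimately have "g \<otimes>\<^bsub>P\<^esub> q \<in> Q"
        unfolding qr(3) by (rule Q.mem_diff_cancel) (use gc qr(1) in simp)
      then show "Q \<in> {Q \<in> ?T f. g \<in> Q} \<union> ?T q" using Q.I_prime[OF gc qr(1)] Q by blast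
    qed
    have "?T q \<subseteq> ?T f"
    proof
      fix Q assume Q: "Q \<in> ?T q"
      interpret Q: primeideal Q P using Q by blast
      have "r \<in> Q" using qr(2) U_subset[OF Q] by blast
      then have "const (c [^] k) \<otimes>\<^bsub>P\<^esub> f \<in> Q"
        unfolding qr(3) using Q.I_l_closed[OF _ gc] Q by simp
      then have "f \<in> Q" by (rule cancel[OF Q _ less.prems(1)])
      then show "Q \<in> ?T f" using Q by blast
    qed
    then have "minimal_members (?T f) \<subseteq>
        minimal_members {Q \<in> ?T f. g \<in> Q} \<union> minimal_members (?T q)"
      by (intro minimal_members_Un_subset[OF cover]) auto
    moreover have "N \<in> {Q \<in> ?T f. g \<in> Q}" using N g(1) by blast
    then have "minimal_members {Q \<in> ?T f. g \<in> Q} \<subseteq> {N}"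
      using N_subset unfolding minimal_members_def by blast
    moreover have "finite (minimal_members (?T q))"
      by (rule less.IH[OF \<open>e < n\<close> qr(1) e])
    ultimately show ?thesis by (meson finite.emptyI finite.insertI finite_UnI finite_subset)
  qed
qed

section \<open>Minimal primes over constants and one nonconstant generator\<close>

lemma UP_ideal_mono: "L \<subseteq> J \<Longrightarrow> UP_ideal R L \<subseteq> UP_ideal R J"
  by (auto simp: UP_ideal_def)

text \<open>Going down for the extension \<open>R \<subseteq> R[x]/(f)\<close> after inverting the leading coefficient of \<open>f\<close>.
  For a prime \<open>L\<close> below the contraction of \<open>Q\<close>, a prime containing \<open>f\<close> and \<open>L\<close> and avoiding the
  products \<open>d g\<close> with \<open>d \<notin> L\<close> and \<open>g \<notin> Q\<close> lies in \<open>Q\<close> and over \<open>L\<close>.\<close>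

lemma contraction_minimal:
  assumes F: "F \<subseteq> carrier R" and f: "f \<in> carrier P"
    and Q: "Q \<in> minimal_members (prime_locus P \<one>\<^bsub>P\<^esub> (insert f (const ` F)))"
    and lc: "const (cf f (deg R f)) \<notin> Q"
  shows "contraction R const Q \<in> minimal_members (prime_locus R \<one> F)"
proof -
  interpret h: ring_hom_cring R P const by (rule const_hom)
  have Qp: "primeideal Q P" "f \<in> Q" "const ` F \<subseteq> Q"
    and Qmin: "\<forall>N. primeideal N P \<and> f \<in> N \<and> const ` F \<subseteq> N \<and> N \<subseteq> Q \<longrightarrow> N = Q"
    using Q by (auto simp: minimal_members_def prime_locus_one)
  interpret Q: primeideal Q P by (rule Qp)
  let ?c = "cf f (deg R f)"
  have c: "?c \<in> carrier R" using f by simp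
  have least: "contraction R const Q \<subseteq> L"
    if "primeideal L R" and FL: "F \<subseteq> L" and LQ: "L \<subseteq> contraction R const Q" for L
  proof -
    interpret L: primeideal L R by fact
    interpret U: primeideal "UP_ideal R L" P by (rule UP_ideal_primeideal[OF L.primeideal])
    have constLQ: "const ` L \<subseteq> Q" using LQ by (auto simp: contraction_def)
    have UQ: "UP_ideal R L \<subseteq> Q" by (rule UP_ideal_least[OF Q.is_ideal constLQ L.a_subset])
    define M where "M = (\<lambda>(d, g). const d \<otimes>\<^bsub>P\<^esub> g) ` ((carrier R - L) \<times> (carrier P - Q))"
    have M_I: "const d \<otimes>\<^bsub>P\<^esub> g \<in> M" if "d \<in> carrier R" "d \<notin> L" "g \<in> carrier P" "g \<notin> Q" for d g
      using that by (auto simp: M_def)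
    have M_E: "\<exists>d g. d \<in> carrier R \<and> d \<notin> L \<and> g \<in> carrier P \<and> g \<notin> Q \<and> m = const d \<otimes>\<^bsub>P\<^esub> g"
      if "m \<in> M" for m
      using that by (auto simp: M_def)
    let ?I = "principal_plus P f (UP_ideal R L)"
    have U_carr: "p \<in> carrier P" if "p \<in> UP_ideal R L" for p using that by (simp add: UP_ideal_iff)
    have "ideal ?I P" by (rule P.principal_plus_ideal[OF U.is_ideal f])
    \<comment> \<open>The core of going down. Suppose \<open>d g = f h + p\<close> with
      \<open>p\<close> in \<open>L[x]\<close>. A power of \<open>c\<close> makes \<open>h\<close>
      divisible by \<open>d\<close> modulo \<open>L[x]\<close>, say
      \<open>c^k h = d h' + p'\<close>. Cancelling \<open>d\<close> yields
      \<open>c^k g = f h'\<close> modulo \<open>L[x]\<close>; the right side lies in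
      \<open>Q\<close>, although neither \<open>c\<close> nor \<open>g\<close> does.\<close>
    moreover have "?I \<inter> M = {}"
    proof (rule ccontr)
      assume "?I \<inter> M \<noteq> {}"
      then obtain m where m: "m \<in> ?I" "m \<in> M" by blast
      obtain d g where dg: "d \<in> carrier R" "d \<notin> L" "g \<in> carrier P" "g \<notin> Q"
        and mdg: "m = const d \<otimes>\<^bsub>P\<^esub> g" using M_E[OF m(2)] by blast
      obtain h p where hp: "h \<in> carrier P" "p \<in> UP_ideal R L"
        and eq: "const d \<otimes>\<^bsub>P\<^esub> g = (f \<otimes>\<^bsub>P\<^esub> h) \<oplus>\<^bsub>P\<^esub> p"
        using m(1) unfolding mdg by (rule principal_plusE)
      \<comment> \<open>Modulo \<open>?J = L + d R\<close> the product \<open>d g\<close> vanishes,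
        and with it \<open>f h\<close>, so a power of \<open>c\<close> carries \<open>h\<close> into
        \<open>?J[x]\<close>. As \<open>?K = d R[x] + L[x]\<close> contains \<open>?J[x]\<close>,
        membership in \<open>?K\<close> supplies the cofactor \<open>h'\<close>.\<close>
      let ?J = "principal_plus R d L"
      let ?K = "principal_plus P (const d) (UP_ideal R L)"
      have J: "ideal ?J R" by (rule R.principal_plus_ideal[OF L.is_ideal dg(1)])
      have d: "const d \<in> carrier P" using dg(1) by simp
      have K: "ideal ?K P" by (rule P.principal_plus_ideal[OF U.is_ideal d])
      interpret UJ: ideal "UP_ideal R ?J" P by (rule UP_ideal_ideal[OF J])
      have pJ: "p \<in> UP_ideal R ?J"
        using hp(2) UP_ideal_mono[OF R.principal_plus_contains(2)[OF L.is_ideal dg(1)]] by blast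
      have "const d \<in> UP_ideal R ?J"
        unfolding const_mem_UP_ideal_iff[OF J dg(1)]
        by (rule R.principal_plus_contains(1)[OF L.is_ideal dg(1)])
      then have "(f \<otimes>\<^bsub>P\<^esub> h) \<oplus>\<^bsub>P\<^esub> p \<in> UP_ideal R ?J"
        unfolding eq[symmetric] by (rule UJ.I_r_closed[OF _ dg(3)])
      then have fh: "f \<otimes>\<^bsub>P\<^esub> h \<in> UP_ideal R ?J"
        by (rule UJ.mem_diff_cancel[OF _ pJ]) (use f hp(1) in simp)
      have "\<forall>i>deg R f. cf f i \<in> ?J"
        using deg_aboveD[OF _ f] additive_subgroup.zero_closed[OF ideal.axioms(1)[OF J]] by simp
      then obtain k :: nat where k: "const (?c [^] k) \<otimes>\<^bsub>P\<^esub> h \<in> UP_ideal R ?J"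
        using const_pow_mult_mem[OF J f _ hp(1) fh] by blast
      have "const ` ?J \<subseteq> ?K"
      proof
        fix x assume "x \<in> const ` ?J"
        then obtain j where j: "j \<in> ?J" "x = const j" by blast
        obtain y l where yl: "y \<in> carrier R" "l \<in> L" "j = (d \<otimes> y) \<oplus> l"
          using j(1) by (rule principal_plusE)
        have lc: "l \<in> carrier R" by (rule L.Icarr[OF yl(2)])
        have "x = (const d \<otimes>\<^bsub>P\<^esub> const y) \<oplus>\<^bsub>P\<^esub> const l"
          unfolding j(2) yl(3) using h.hom_add[OF R.m_closed[OF dg(1) yl(1)] lc] h.hom_mult[OF dg(1) yl(1)]
          by simp
        moreover have "const y \<in> carrier P" using yl(1) by simp
        moreover have "const l \<in> UP_ideal R L"
          using const_mem_UP_ideal_iff[OF L.is_ideal lc] yl(2) by simp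
        ultimately show "x \<in> ?K" using principal_plusI by metis
      qed
      then have "UP_ideal R ?J \<subseteq> ?K"
        by (rule UP_ideal_least[OF K]) (use ideal.Icarr[OF J] in auto)
      then have "const (?c [^] k) \<otimes>\<^bsub>P\<^esub> h \<in> ?K" using k by blast
      then obtain h' p' where hp': "h' \<in> carrier P" "p' \<in> UP_ideal R L"
        "const (?c [^] k) \<otimes>\<^bsub>P\<^esub> h = (const d \<otimes>\<^bsub>P\<^esub> h') \<oplus>\<^bsub>P\<^esub> p'" by (rule principal_plusE)
      define C where "C = const (?c [^] k)"
      have C: "C \<in> carrier P" using c by (simp add: C_def)
      note carr = f hp(1) hp'(1) U_carr[OF hp(2)] U_carr[OF hp'(2)] C d dg(3)
      \<comment> \<open>The aim is \<open>d u = f p' + C p\<close>, which is in \<open>L[x]\<close>.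
        Since \<open>L[x]\<close> is prime and \<open>d\<close> is outside \<open>L\<close>, it
        follows that \<open>u\<close> is in \<open>L[x]\<close>.\<close>
      define u where "u = (C \<otimes>\<^bsub>P\<^esub> g) \<ominus>\<^bsub>P\<^esub> (f \<otimes>\<^bsub>P\<^esub> h')"
      have u: "u \<in> carrier P" using carr by (simp add: u_def)
      have Cg: "C \<otimes>\<^bsub>P\<^esub> g = (f \<otimes>\<^bsub>P\<^esub> h') \<oplus>\<^bsub>P\<^esub> u"
        using carr by (simp add: u_def a_minus_def P.a_ac P.r_neg P.r_neg1)
      have "const d \<otimes>\<^bsub>P\<^esub> (C \<otimes>\<^bsub>P\<^esub> g) = C \<otimes>\<^bsub>P\<^esub> ((f \<otimes>\<^bsub>P\<^esub> h) \<oplus>\<^bsub>P\<^esub> p)"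
        unfolding eq[symmetric] using carr by (simp add: P.m_lcomm)
      also have "\<dots> = (f \<otimes>\<^bsub>P\<^esub> (C \<otimes>\<^bsub>P\<^esub> h)) \<oplus>\<^bsub>P\<^esub> (C \<otimes>\<^bsub>P\<^esub> p)"
        using carr by (simp add: P.r_distr P.m_lcomm)
      also have "\<dots> = (const d \<otimes>\<^bsub>P\<^esub> (f \<otimes>\<^bsub>P\<^esub> h')) \<oplus>\<^bsub>P\<^esub> ((f \<otimes>\<^bsub>P\<^esub> p') \<oplus>\<^bsub>P\<^esub> (C \<otimes>\<^bsub>P\<^esub> p))"
        unfolding hp'(3)[folded C_def] using carr by (simp add: P.r_distr P.m_lcomm P.a_assoc)
      finally have dCg: "const d \<otimes>\<^bsub>P\<^esub> (C \<otimes>\<^bsub>P\<^esub> g) =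
        (const d \<otimes>\<^bsub>P\<^esub> (f \<otimes>\<^bsub>P\<^esub> h')) \<oplus>\<^bsub>P\<^esub> ((f \<otimes>\<^bsub>P\<^esub> p') \<oplus>\<^bsub>P\<^esub> (C \<otimes>\<^bsub>P\<^esub> p))" .
      have "(const d \<otimes>\<^bsub>P\<^esub> (f \<otimes>\<^bsub>P\<^esub> h')) \<oplus>\<^bsub>P\<^esub> (const d \<otimes>\<^bsub>P\<^esub> u) =
        const d \<otimes>\<^bsub>P\<^esub> (C \<otimes>\<^bsub>P\<^esub> g)"
        unfolding Cg using carr u by (intro P.r_distr[symmetric]) auto
      then have "(const d \<otimes>\<^bsub>P\<^esub> (f \<otimes>\<^bsub>P\<^esub> h')) \<oplus>\<^bsub>P\<^esub> (const d \<otimes>\<^bsub>P\<^esub> u) =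
        (const d \<otimes>\<^bsub>P\<^esub> (f \<otimes>\<^bsub>P\<^esub> h')) \<oplus>\<^bsub>P\<^esub> ((f \<otimes>\<^bsub>P\<^esub> p') \<oplus>\<^bsub>P\<^esub> (C \<otimes>\<^bsub>P\<^esub> p))"
        unfolding dCg .
      then have "const d \<otimes>\<^bsub>P\<^esub> u = (f \<otimes>\<^bsub>P\<^esub> p') \<oplus>\<^bsub>P\<^esub> (C \<otimes>\<^bsub>P\<^esub> p)"
        using carr u by (simp only: P.add.l_cancel P.m_closed P.a_closed)
      moreover have "(f \<otimes>\<^bsub>P\<^esub> p') \<oplus>\<^bsub>P\<^esub> (C \<otimes>\<^bsub>P\<^esub> p) \<in> UP_ideal R L"
        using U.I_l_closed hp(2) hp'(2) f C by (intro U.a_closed) auto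
      ultimately have "u \<in> UP_ideal R L"
        using U.I_prime[OF d u] const_mem_UP_ideal_iff[OF L.is_ideal dg(1)] dg(2) by simp
      then have "u \<in> Q" using UQ by blast
      moreover have "f \<otimes>\<^bsub>P\<^esub> h' \<in> Q" by (rule Q.I_r_closed[OF Qp(2) hp'(1)])
      ultimately have "C \<otimes>\<^bsub>P\<^esub> g \<in> Q"
        unfolding Cg by (rule Q.a_closed[rotated])
      then have "C \<in> Q" using Q.I_prime[OF C dg(3)] dg(4) by blast
      then have "?c [^] k \<in> contraction R const Q" using c by (simp add: contraction_def C_def)
      moreover have "?c \<notin> contraction R const Q" using lc by (simp add: contraction_def)
      ultimately show False
        using primeideal.pow_notin[OF h.primeideal_contraction[OF Qp(1)] c] by blast
    qed
    moreover have "M \<subseteq> carrier P" by (auto simp: M_def)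
    \<comment> \<open>Taking \<open>d = 1\<close>, the set \<open>M\<close> contains everything
      outside \<open>Q\<close>, which forces \<open>N \<subseteq> Q\<close> and, by minimality of
      \<open>Q\<close>, equality. Taking \<open>g = 1\<close>, it contains the constants outside
      \<open>L\<close>, so that \<open>N\<close> contracts into \<open>L\<close>.\<close>
    moreover have one_mem: "g \<in> M" if "g \<in> carrier P" "g \<notin> Q" for g
    proof -
      have "g = const \<one> \<otimes>\<^bsub>P\<^esub> g" using that by simp
      then show ?thesis using M_I[OF R.one_closed L.one_notin that] by simp
    qed
    then have "M \<noteq> {}" using Q.one_notin P.one_closed by blast
    moreover have "a \<otimes>\<^bsub>P\<^esub> b \<in> M" if ab: "a \<in> M" "b \<in> M" for a b
    proof -
      obtain d g d' g' where a: "d \<in> carrier R" "d \<notin> L" "g \<in> carrier P" "g \<notin> Q"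
        "a = const d \<otimes>\<^bsub>P\<^esub> g" and b: "d' \<in> carrier R" "d' \<notin> L" "g' \<in> carrier P" "g' \<notin> Q"
        "b = const d' \<otimes>\<^bsub>P\<^esub> g'" using M_E[OF ab(1)] M_E[OF ab(2)] by blast
      have "a \<otimes>\<^bsub>P\<^esub> b = const (d \<otimes> d') \<otimes>\<^bsub>P\<^esub> (g \<otimes>\<^bsub>P\<^esub> g')"
        unfolding a(5) b(5) h.hom_mult[OF a(1) b(1)] using a b by (simp add: P.m_ac)
      then show ?thesis
        using M_I[of "d \<otimes> d'" "g \<otimes>\<^bsub>P\<^esub> g'"] L.mult_notin[OF a(1) b(1) a(2) b(2)]
          Q.mult_notin[OF a(3) b(3) a(4) b(4)] a b by simp
    qed
    ultimately obtain N where N: "primeideal N P" "?I \<subseteq> N" "N \<inter> M = {}"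
      using P.exists_prime_avoiding[of ?I M] by blast
    interpret N: primeideal N P by (rule N)
    have "N \<subseteq> Q" using N.Icarr one_mem N(3) by blast
    moreover have "f \<in> N"
      using P.principal_plus_contains(1)[OF U.is_ideal f] N(2) by blast
    moreover have "const ` F \<subseteq> N"
    proof
      fix p assume "p \<in> const ` F"
      then obtain x where x: "x \<in> F" "p = const x" by blast
      then have xc: "x \<in> carrier R" using F by blast
      have "p \<in> UP_ideal R L" using const_mem_UP_ideal_iff[OF L.is_ideal xc] x FL by blast
      then show "p \<in> N" using P.principal_plus_contains(2)[OF U.is_ideal f] N(2) by blast
    qed
    ultimately have NQ: "N = Q" using Qmin N(1) by blast
    show ?thesis
    proof
      fix d assume d: "d \<in> contraction R const Q"
      then have dc: "d \<in> carrier R" "const d \<in> N" by (auto simp: contraction_def NQ)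
      show "d \<in> L"
      proof (rule ccontr)
        assume "d \<notin> L"
        then have "const d \<otimes>\<^bsub>P\<^esub> \<one>\<^bsub>P\<^esub> \<in> M" by (rule M_I[OF dc(1) _ P.one_closed Q.one_notin])
        then have "const d \<in> M" using dc(1) by simp
        then show False using dc(2) N(3) by blast
      qed
    qed
  qed
  show ?thesis
    unfolding minimal_members_def prime_locus_one
  proof (intro CollectI conjI ballI impI)
    show "primeideal (contraction R const Q) R" by (rule h.primeideal_contraction[OF Qp(1)])
    show "F \<subseteq> contraction R const Q" using F Qp(3) by (auto simp: contraction_def)
    fix L assume "L \<in> {L. primeideal L R \<and> F \<subseteq> L}" "L \<subseteq> contraction R const Q"
    then show "L = contraction R const Q" using least[of L] by (intro subset_antisym) simp_all
  qed
qed

text \<open>By going down such a \<open>Q\<close> contracts to one of finitely many primes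
  \<open>L\<close>, none containing the leading coefficient. It is also minimal in its fibre: a
  prime over the same \<open>L\<close> contains the constants from \<open>F\<close> automatically,
  so within the fibre only \<open>f\<close> has to be required.\<close>

lemma finite_minimal_lcoeff_notin:
  assumes R: "fgfc_ring R" and F: "finite F" "F \<subseteq> carrier R" and f: "f \<in> carrier P"
  shows "finite {Q \<in> minimal_members (prime_locus P \<one>\<^bsub>P\<^esub> (insert f (const ` F))).
    const (cf f (deg R f)) \<notin> Q}" (is "finite ?S")
proof -
  let ?n = "deg R f"
  let ?T = "\<lambda>L. {Q. primeideal Q P \<and> contraction R const Q = L \<and> f \<in> Q}"
  let ?A = "{L \<in> minimal_members (prime_locus R \<one> F). cf f ?n \<notin> L}"
  have "finite ?A" using R F fgfc_ring_iff[OF R.is_cring] by simp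
  moreover have "finite (minimal_members (?T L))" if "L \<in> ?A" for L
  proof (rule finite_minimal_fibre[OF _ f])
    show L: "primeideal L R" using that by (simp add: minimal_members_def prime_locus_one)
    show "cf f ?n \<notin> L" using that by blast
    show "\<forall>i>?n. cf f i \<in> L"
      using deg_aboveD[OF _ f] additive_subgroup.zero_closed[OF ideal.axioms(1)[OF primeideal.axioms(1)[OF L]]]
      by simp
  qed
  ultimately have "finite (\<Union>L\<in>?A. minimal_members (?T L))" by blast
  moreover have "?S \<subseteq> (\<Union>L\<in>?A. minimal_members (?T L))"
  proof
    fix Q assume Q: "Q \<in> ?S"
    let ?L = "contraction R const Q"
    have mem: "primeideal Q P" "f \<in> Q" "const ` F \<subseteq> Q"
      and least: "\<forall>N. primeideal N P \<and> insert f (const ` F) \<subseteq> N \<and> N \<subseteq> Q \<longrightarrow> N = Q"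
      using Q by (auto simp: minimal_members_def prime_locus_one)
    have "?L \<in> ?A" using Q contraction_minimal[OF F(2) f, of Q] f by (simp add: contraction_def)
    moreover have "Q \<in> minimal_members (?T ?L)"
      unfolding minimal_members_def
    proof (intro CollectI conjI ballI impI)
      fix N assume N: "N \<in> ?T ?L" "N \<subseteq> Q"
      have "const x \<in> N" if "x \<in> F" for x
      proof -
        have "x \<in> ?L" using that mem(3) F(2) by (auto simp: contraction_def)
        then have "x \<in> contraction R const N" using N(1) by simp
        then show ?thesis by (simp add: contraction_def)
      qed
      then show "N = Q" using least N by blast
    qed (use mem in auto)
    ultimately show "Q \<in> (\<Union>L\<in>?A. minimal_members (?T L))" by blast
  qed
  ultimately show ?thesis by (rule rev_finite_subset)
qed

section \<open>Elimination of nonconstant generators\<close>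

lemma const_mult_mem_iff:
  assumes "primeideal Q P" "a \<in> carrier R" "b \<in> carrier R"
  shows "const (a \<otimes> b) \<in> Q \<longleftrightarrow> const a \<in> Q \<or> const b \<in> Q"
proof -
  interpret Q: primeideal Q P by fact
  have "const (a \<otimes> b) = const a \<otimes>\<^bsub>P\<^esub> const b"
    using monom_mult[OF assms(2,3), of 0 0] by simp
  then show ?thesis
    using Q.I_prime[of "const a" "const b"] Q.I_l_closed[of "const b" "const a"]
      Q.I_r_closed[of "const a" "const b"] assms(2,3) by auto
qed

text \<open>Pseudo-division gives \<open>c^k g = f q + r\<close>. For a prime that contains
  \<open>f\<close> and avoids \<open>c\<close>, containing \<open>g\<close> and containing
  \<open>r\<close> are therefore equivalent.\<close>

lemma prime_locus_reduce:
  assumes F: "F \<subseteq> carrier P" and f: "f \<in> F" and g: "g \<in> F" "g \<noteq> f" and a: "a \<in> carrier R"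
    and f0: "f \<noteq> \<zero>\<^bsub>P\<^esub>" and le: "0 < deg R f" "deg R f \<le> deg R g"
  shows "\<exists>r \<in> carrier P. deg R r < deg R g \<and>
    prime_locus P (const (a \<otimes> cf f (deg R f))) F =
    prime_locus P (const (a \<otimes> cf f (deg R f))) (insert r (F - {g}))"
proof -
  let ?c = "cf f (deg R f)"
  have fc: "f \<in> carrier P" and gc: "g \<in> carrier P" using F f g by auto
  have c: "?c \<in> carrier R" using fc by simp
  obtain q r and k :: nat where qr: "q \<in> carrier P" "r \<in> carrier P"
    "?c [^] k \<odot>\<^bsub>P\<^esub> g = (f \<otimes>\<^bsub>P\<^esub> q) \<oplus>\<^bsub>P\<^esub> r" "r = \<zero>\<^bsub>P\<^esub> \<or> deg R r < deg R f"
    using long_div_theorem[OF fc gc f0] by metis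
  have eq: "const (?c [^] k) \<otimes>\<^bsub>P\<^esub> g = r \<oplus>\<^bsub>P\<^esub> (f \<otimes>\<^bsub>P\<^esub> q)"
    using qr c gc fc by (simp add: monom_mult_is_smult P.a_comm)
  have ck: "const (?c [^] k) \<in> carrier P" using c by simp
  have "g \<in> Q \<longleftrightarrow> r \<in> Q" if Q: "primeideal Q P" "const (a \<otimes> ?c) \<notin> Q" "f \<in> Q" for Q
  proof -
    interpret Q: primeideal Q P by (rule Q(1))
    interpret L: primeideal "contraction R const Q" R
      by (rule ring_hom_cring.primeideal_contraction[OF const_hom Q(1)])
    have fq: "f \<otimes>\<^bsub>P\<^esub> q \<in> Q" by (rule Q.I_r_closed[OF Q(3) qr(1)])
    have "const ?c \<notin> Q" using Q(2) const_mult_mem_iff[OF Q(1) a c] by blast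
    then have "?c \<notin> contraction R const Q" unfolding mem_contraction_iff by blast
    then have "?c [^] k \<notin> contraction R const Q" by (rule L.pow_notin[OF c])
    then have ckQ: "const (?c [^] k) \<notin> Q"
      using R.nat_pow_closed[OF c] unfolding mem_contraction_iff by blast
    have "g \<in> Q \<longleftrightarrow> const (?c [^] k) \<otimes>\<^bsub>P\<^esub> g \<in> Q"
      using Q.I_prime[OF ck gc] Q.I_l_closed[OF _ ck] ckQ by blast
    also have "\<dots> \<longleftrightarrow> r \<in> Q"
      unfolding eq using Q.mem_diff_cancel[OF _ fq qr(2)] Q.a_closed[OF _ fq] by blast
    finally show ?thesis .
  qed
  then have "prime_locus P (const (a \<otimes> ?c)) F = prime_locus P (const (a \<otimes> ?c)) (insert r (F - {g}))"
    using f g by (auto simp: prime_locus_def)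
  \<comment> \<open>If the remainder is zero, its degree is 0 by convention, and the strict
    inequality comes from \<open>0 < deg R f\<close>.\<close>
  moreover have "deg R r < deg R g" using qr(4) le by auto
  ultimately show ?thesis using qr(2) by blast
qed

text \<open>The element \<open>a\<close> is generalized in the induction because the branch of
  primes avoiding \<open>c\<close> replaces it by \<open>a \<otimes> c\<close>.\<close>

lemma finite_minimal_prime_locus:
  assumes R: "fgfc_ring R" and "finite F" "F \<subseteq> carrier P" "a \<in> carrier R"
  shows "finite (minimal_members (prime_locus P (const a) F))"
  using assms(2-)
proof (induction "\<Sum>g\<in>F. deg R g" arbitrary: F a rule: less_induct)
  case less
  note F = less.prems
  have const_image: "const ` (\<lambda>g. cf g 0) ` G = G" if "G \<subseteq> carrier P" "\<forall>g\<in>G. deg R g = 0" for G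
  proof -
    have "const (cf g 0) = g" if "g \<in> G" for g
      using deg_zero_impl_monom[of g] that \<open>G \<subseteq> carrier P\<close> \<open>\<forall>g\<in>G. deg R g = 0\<close> by auto
    then show ?thesis by (simp add: image_image)
  qed
  show ?case
  proof (cases "\<exists>f\<in>F. deg R f \<noteq> 0")
    case False
    let ?G = "(\<lambda>g. cf g 0) ` F"
    have G: "finite ?G" "?G \<subseteq> carrier R" using F by auto
    have "finite (minimal_members (prime_locus R \<one> ?G))"
      using R G fgfc_ring_iff[OF R.is_cring] by blast
    then have "finite (minimal_members (prime_locus P \<one>\<^bsub>P\<^esub> (const ` ?G)))"
      by (rule finite_minimal_members_extension[OF extends_primes_const G(2)])
    then have "finite (minimal_members (prime_locus P \<one>\<^bsub>P\<^esub> F))"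
      using const_image[OF F(2)] False by simp
    then show ?thesis by (rule finite_subset[OF minimal_members_prime_locus_subset])
  next
    case True
    then obtain f where f: "f \<in> F" "deg R f \<noteq> 0"
      and least: "\<forall>g. g \<in> F \<and> deg R g \<noteq> 0 \<longrightarrow> deg R f \<le> deg R g"
      using ex_has_least_nat[of "\<lambda>g. g \<in> F \<and> deg R g \<noteq> 0" _ "deg R"] by blast
    have fc: "f \<in> carrier P" using f F by blast
    define n where "n = deg R f"
    define c where "c = cf f n"
    have c: "c \<in> carrier R" using fc by (simp add: c_def)
    have f0: "f \<noteq> \<zero>\<^bsub>P\<^esub>" using f(2) by auto
    have sum_F: "(\<Sum>g\<in>F. deg R g) = deg R g + (\<Sum>g\<in>F - {g}. deg R g)" if "g \<in> F" for g
      using F(1) that by (rule sum.remove)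
    \<comment> \<open>Only an inequality, because the inserted polynomial may already be among the
      generators.\<close>
    have sum_insert: "(\<Sum>g\<in>insert r G. deg R g) \<le> deg R r + (\<Sum>g\<in>G. deg R g)" if "finite G" for r G
      using that by (cases "r \<in> G") (auto simp: insert_absorb)
    \<comment> \<open>A prime containing \<open>c\<close> contains the leading term of
      \<open>f\<close>, hence contains \<open>f\<close> exactly if it contains the tail
      \<open>?t\<close>. The set \<open>?G\<close> may be larger than \<open>F\<close>, but
      \<open>const c\<close> has degree 0 and \<open>?t\<close> has degree below
      \<open>n\<close>.\<close>
    let ?t = "f \<ominus>\<^bsub>P\<^esub> mon c n"
    let ?G = "insert ?t (insert (const c) (F - {f}))"
    have mc: "mon c n \<in> carrier P" using c by simp
    have t: "?t \<in> carrier P" using fc mc by simp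
    have deg_t: "deg R ?t < n"
    proof -
      have "deg R ?t \<le> n - 1"
      proof (rule deg_aboveI[OF _ t])
        fix i assume i: "n - 1 < i"
        show "cf ?t i = \<zero>"
        proof (cases "i = n")
          case True
          then show ?thesis using fc mc c by (simp add: coeff_minus c_def R.minus_eq R.r_neg)
        next
          case False
          then show ?thesis
            using i fc mc c deg_aboveD[of f i] by (simp add: coeff_minus n_def R.minus_eq)
        qed
      qed
      then show ?thesis using f(2) n_def by simp
    qed
    have "finite (minimal_members (prime_locus P (const a) ?G))"
    proof (rule less.hyps)
      have "(\<Sum>g\<in>?G. deg R g) \<le> deg R ?t + (deg R (const c) + (\<Sum>g\<in>F - {f}. deg R g))"
        using sum_insert[of "insert (const c) (F - {f})" ?t] sum_insert[of "F - {f}" "const c"] F(1)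
        by simp
      also have "\<dots> < (\<Sum>g\<in>F. deg R g)"
        using deg_t c sum_F[OF f(1)] by (simp add: n_def)
      finally show "(\<Sum>g\<in>?G. deg R g) < (\<Sum>g\<in>F. deg R g)" .
    qed (use F t c in auto)
    moreover have "finite (minimal_members (prime_locus P (const (a \<otimes> c)) F))"
    proof (cases "\<exists>g\<in>F. g \<noteq> f \<and> deg R g \<noteq> 0")
      case True
      then obtain g where g: "g \<in> F" "g \<noteq> f" "deg R g \<noteq> 0" by blast
      have le: "deg R f \<le> deg R g" using least g by blast
      obtain r where r: "r \<in> carrier P" "deg R r < deg R g"
        "prime_locus P (const (a \<otimes> c)) F = prime_locus P (const (a \<otimes> c)) (insert r (F - {g}))"
        using prime_locus_reduce[OF F(2) f(1) g(1,2) F(3) f0 _ le] f(2) unfolding c_def n_def by blast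
      show ?thesis
        unfolding r(3)
      proof (rule less.hyps)
        show "(\<Sum>g\<in>insert r (F - {g}). deg R g) < (\<Sum>g\<in>F. deg R g)"
          using sum_insert[of "F - {g}" r] sum_F[OF g(1)] r(2) F(1) by simp
      qed (use F r(1) c in auto)
    next
      case False
      let ?H = "(\<lambda>g. cf g 0) ` (F - {f})"
      have "const ` ?H = F - {f}" using const_image[of "F - {f}"] F(2) False by blast
      then have H: "insert f (const ` ?H) = F" using f(1) by auto
      have fin: "finite {Q \<in> minimal_members (prime_locus P \<one>\<^bsub>P\<^esub> (insert f (const ` ?H))). const c \<notin> Q}"
        unfolding c_def n_def
        by (rule finite_minimal_lcoeff_notin[OF R _ _ fc]) (use F in auto)
      \<comment> \<open>The finiteness just obtained concerns primes minimal in all of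
        \<open>V(F)\<close>, whereas the goal concerns minimality among primes avoiding
        \<open>a \<otimes> c\<close>; the latter primes are among the former.\<close>
      have "minimal_members (prime_locus P (const (a \<otimes> c)) F) \<subseteq>
          {Q \<in> minimal_members (prime_locus P \<one>\<^bsub>P\<^esub> F). const c \<notin> Q}"
      proof
        fix Q assume Q: "Q \<in> minimal_members (prime_locus P (const (a \<otimes> c)) F)"
        then have "primeideal Q P" "const (a \<otimes> c) \<notin> Q"
          by (simp_all add: minimal_members_def prime_locus_def)
        then have "const c \<notin> Q" using const_mult_mem_iff[OF _ F(3) c] by blast
        then show "Q \<in> {Q \<in> minimal_members (prime_locus P \<one>\<^bsub>P\<^esub> F). const c \<notin> Q}"
          using subsetD[OF minimal_members_prime_locus_subset Q] by blast
      qed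
      then show ?thesis using fin unfolding H by (rule finite_subset)
    qed
    moreover have "minimal_members (prime_locus P (const a) F) \<subseteq>
        minimal_members (prime_locus P (const (a \<otimes> c)) F) \<union> minimal_members (prime_locus P (const a) ?G)"
    proof (rule minimal_members_Un_subset)
      have tf: "?t \<in> Q \<longleftrightarrow> f \<in> Q" if Q: "primeideal Q P" "const c \<in> Q" for Q
      proof -
        interpret Q: primeideal Q P by (rule Q(1))
        have "const c \<otimes>\<^bsub>P\<^esub> mon \<one> n \<in> Q" by (rule Q.I_r_closed[OF Q(2)]) simp
        then have mQ: "mon c n \<in> Q" using monom_mult[OF c R.one_closed, of 0 n] c by simp
        have "f = ?t \<oplus>\<^bsub>P\<^esub> mon c n" using fc mc by (simp add: a_minus_def P.a_assoc P.l_neg)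
        then show ?thesis
          using Q.diff_closed[OF _ mQ] Q.a_closed[OF _ mQ] by metis
      qed
      show "prime_locus P (const a) F \<subseteq> prime_locus P (const (a \<otimes> c)) F \<union> prime_locus P (const a) ?G"
      proof
        fix Q assume "Q \<in> prime_locus P (const a) F"
        then have Q: "primeideal Q P" "F \<subseteq> Q" "const a \<notin> Q" by (simp_all add: prime_locus_def)
        show "Q \<in> prime_locus P (const (a \<otimes> c)) F \<union> prime_locus P (const a) ?G"
        proof (cases "const c \<in> Q")
          case True
          then have "?t \<in> Q" using tf[OF Q(1)] f(1) Q(2) by blast
          then show ?thesis using Q True by (auto simp: prime_locus_def)
        next
          case False
          then show ?thesis using Q const_mult_mem_iff[OF Q(1) F(3) c] by (simp add: prime_locus_def)
        qed
      qed
      show "prime_locus P (const (a \<otimes> c)) F \<subseteq> prime_locus P (const a) F"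
        using const_mult_mem_iff[OF _ F(3) c] by (auto simp: prime_locus_def)
      show "prime_locus P (const a) ?G \<subseteq> prime_locus P (const a) F"
      proof
        fix Q assume "Q \<in> prime_locus P (const a) ?G"
        then have Q: "primeideal Q P" "?t \<in> Q" "const c \<in> Q" "F - {f} \<subseteq> Q" "const a \<notin> Q"
          by (simp_all add: prime_locus_def)
        then have "f \<in> Q" using tf by blast
        then show "Q \<in> prime_locus P (const a) F" using Q by (auto simp: prime_locus_def)
      qed
    qed
    ultimately show ?thesis by (meson finite_UnI finite_subset)
  qed
qed

theorem fgfc_ring_UP:
  assumes "fgfc_ring R"
  shows "fgfc_ring P"
  using finite_minimal_prime_locus[OF assms _ _ R.one_closed] fgfc_ring_iff[OF UP_cring] by simp

end

section \<open>Polynomials in a set of indeterminates\<close>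

lemma finite_submultisets: "finite {a. a \<subseteq># m}"
proof (induction m)
  case (add x m)
  have "{a. a \<subseteq># add_mset x m} \<subseteq> {a. a \<subseteq># m} \<union> add_mset x ` {a. a \<subseteq># m}"
  proof
    fix a assume a: "a \<in> {a. a \<subseteq># add_mset x m}"
    show "a \<in> {a. a \<subseteq># m} \<union> add_mset x ` {a. a \<subseteq># m}"
    proof (cases "x \<in># a")
      case True
      then obtain a' where "a = add_mset x a'" by (metis multi_member_split)
      then show ?thesis using a by simp
    next
      case False
      then have "a - {#x#} = a" by (rule diff_single_trivial)
      then have "a \<subseteq># m" using a subset_eq_diff_conv[of a "{#x#}" m] by simp
      then show ?thesis by blast
    qed
  qed
  then show ?case using add finite_subset by (metis finite_UnI finite_imageI)
qed simp

section \<open>The convolution product and the ring axioms\<close>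

definition mset_splits :: "'c multiset \<Rightarrow> ('c multiset \<times> 'c multiset) set"
  where "mset_splits m = {(a, b). a + b = m}"

lemma finite_mset_splits: "finite (mset_splits m)"
proof (rule finite_subset)
  show "mset_splits m \<subseteq> {a. a \<subseteq># m} \<times> {a. a \<subseteq># m}" by (auto simp: mset_splits_def)
qed (simp add: finite_submultisets)

text \<open>The product does not mention the set of indeterminates, so enlarging this set gives a
  homomorphism whose underlying map is \<open>id\<close>.\<close>

definition (in ring) indexed_mult ::
    "('c multiset \<Rightarrow> 'a) \<Rightarrow> ('c multiset \<Rightarrow> 'a) \<Rightarrow> 'c multiset \<Rightarrow> 'a"
  where "indexed_mult p q = (\<lambda>m. finsum R (\<lambda>ab. p (fst ab) \<otimes> q (snd ab)) (mset_splits m))"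

context cring
begin

lemma coeffs_closed: "p \<in> indexed_pset I (carrier R) \<Longrightarrow> p m \<in> carrier R"
  by (rule carrier_coeffE[OF indexed_pset_in_carrier[OF subset_refl]])

lemma indexed_mult_comm:
  fixes p q :: "'c multiset \<Rightarrow> 'a"
  assumes "carrier_coeff p" "carrier_coeff q"
  shows "indexed_mult p q = indexed_mult q p"
proof
  fix m :: "'c multiset"
  note c = carrier_coeffE[OF assms(1)] carrier_coeffE[OF assms(2)]
  let ?sw = "\<lambda>(a, b). (b, a :: 'c multiset)"
  have im: "?sw ` mset_splits m = mset_splits m"
    by (auto simp: mset_splits_def image_iff add.commute)
  have inj: "inj_on ?sw (mset_splits m)" by (auto simp: inj_on_def)
  have "finsum R (\<lambda>ab. p (fst ab) \<otimes> q (snd ab)) (?sw ` mset_splits m) =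
      finsum R (\<lambda>x. p (fst (?sw x)) \<otimes> q (snd (?sw x))) (mset_splits m)"
    by (rule finsum_reindex[OF _ inj]) (use c in auto)
  also have "\<dots> = finsum R (\<lambda>ab. q (fst ab) \<otimes> p (snd ab)) (mset_splits m)"
    by (rule finsum_cong') (use c m_comm in auto)
  finally show "indexed_mult p q m = indexed_mult q p m" unfolding im indexed_mult_def .
qed

lemma indexed_mult_padd_left:
  assumes "carrier_coeff p" "carrier_coeff p'" "carrier_coeff q"
  shows "indexed_mult (indexed_padd p p') q = indexed_padd (indexed_mult p q) (indexed_mult p' q)"
proof
  fix m
  note c = assms[THEN carrier_coeffE]
  have "finsum R (\<lambda>ab. (p (fst ab) \<oplus> p' (fst ab)) \<otimes> q (snd ab)) (mset_splits m) =
      finsum R (\<lambda>ab. (p (fst ab) \<otimes> q (snd ab)) \<oplus> (p' (fst ab) \<otimes> q (snd ab))) (mset_splits m)"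
    by (rule finsum_cong') (use c l_distr in auto)
  also have "\<dots> = indexed_mult p q m \<oplus> indexed_mult p' q m"
    unfolding indexed_mult_def by (rule finsum_addf) (use c in auto)
  finally show "indexed_mult (indexed_padd p p') q m =
      indexed_padd (indexed_mult p q) (indexed_mult p' q) m"
    by (simp add: indexed_mult_def indexed_padd_def)
qed

lemma indexed_mult_const_left:
  fixes q :: "'c multiset \<Rightarrow> 'a"
  assumes "k \<in> carrier R" "carrier_coeff q"
  shows "indexed_mult (indexed_const k) q = (\<lambda>m. k \<otimes> q m)"
proof
  fix m :: "'c multiset"
  note c = carrier_coeffE[OF assms(2)]
  let ?f = "\<lambda>ab :: 'c multiset \<times> 'c multiset. indexed_const k (fst ab) \<otimes> q (snd ab)"
  have "finsum R ?f (mset_splits m) = finsum R ?f {({#}, m)}"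
  proof (rule add.finprod_mono_neutral_cong_right[OF finite_mset_splits])
    fix ab assume "ab \<in> mset_splits m - {({#}, m)}"
    then have "fst ab \<noteq> {#}" by (auto simp: mset_splits_def)
    then show "?f ab = \<zero>" using c by (simp add: indexed_const_def)
  qed (use assms c in \<open>auto simp: indexed_const_def mset_splits_def\<close>)
  also have "\<dots> = k \<otimes> q m" using assms(1) c by (simp add: indexed_const_def)
  finally show "indexed_mult (indexed_const k) q m = k \<otimes> q m" by (simp add: indexed_mult_def)
qed

text \<open>Splits of \<open>add_mset i m'\<close> with \<open>i\<close> in the first part
  correspond to splits of \<open>m'\<close>; all other splits contribute zero, as
  \<open>indexed_pmult p i\<close> vanishes on monomials without \<open>i\<close>.\<close>

lemma indexed_mult_pmult_left:
  fixes p q :: "'c multiset \<Rightarrow> 'a"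
  assumes "carrier_coeff p" "carrier_coeff q"
  shows "indexed_mult (indexed_pmult p i) q = indexed_pmult (indexed_mult p q) i"
proof
  fix m
  note c = assms[THEN carrier_coeffE]
  let ?f = "\<lambda>ab. indexed_pmult p i (fst ab) \<otimes> q (snd ab)"
  have fc: "?f ab \<in> carrier R" for ab using c by (simp add: indexed_pmult_def)
  show "indexed_mult (indexed_pmult p i) q m = indexed_pmult (indexed_mult p q) i m"
  proof (cases "i \<in># m")
    case False
    have "?f ab = \<zero>" if "ab \<in> mset_splits m" for ab
      using that False c by (auto simp: mset_splits_def indexed_pmult_def)
    then have "finsum R ?f (mset_splits m) = \<zero>" by (rule add.finprod_one_eqI)
    then show ?thesis using False by (simp add: indexed_mult_def indexed_pmult_def)
  next
    case True
    then obtain m' where m: "m = add_mset i m'" by (metis multi_member_split)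
    let ?h = "\<lambda>(a, b). (add_mset i a, b :: 'c multiset)"
    have inj: "inj_on ?h (mset_splits m')" by (auto simp: inj_on_def)
    have "finsum R ?f (mset_splits m) = finsum R ?f (?h ` mset_splits m')"
    proof (rule add.finprod_mono_neutral_cong_right[OF finite_mset_splits])
      show "?h ` mset_splits m' \<subseteq> mset_splits m" by (auto simp: mset_splits_def m)
      fix ab assume ab: "ab \<in> mset_splits m - ?h ` mset_splits m'"
      have "i \<notin># fst ab"
      proof
        assume "i \<in># fst ab"
        then obtain a where a: "fst ab = add_mset i a" by (metis multi_member_split)
        then have "ab = ?h (a, snd ab)" by (metis case_prod_conv prod.collapse)
        moreover have "(a, snd ab) \<in> mset_splits m'"
          using ab a by (cases ab) (simp add: mset_splits_def m)
        ultimately show False using ab by blast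
      qed
      then show "?f ab = \<zero>" using c by (simp add: indexed_pmult_def)
    qed (use fc in auto)
    also have "\<dots> = finsum R (\<lambda>x. ?f (?h x)) (mset_splits m')"
      by (rule finsum_reindex[OF _ inj]) (use fc in auto)
    also have "\<dots> = finsum R (\<lambda>ab. p (fst ab) \<otimes> q (snd ab)) (mset_splits m')"
      by (rule finsum_cong') (use c in \<open>auto simp: indexed_pmult_def\<close>)
    finally show ?thesis by (simp add: indexed_mult_def indexed_pmult_def m)
  qed
qed

lemma indexed_mult_in_carrier:
  assumes "carrier_coeff p" "carrier_coeff q"
  shows "carrier_coeff (indexed_mult p q)"
  using assms[THEN carrier_coeffE] unfolding carrier_coeff_def indexed_mult_def
  by (auto intro!: finsum_closed)

lemma indexed_const_in_pset: "k \<in> carrier R \<Longrightarrow> indexed_const k \<in> indexed_pset I (carrier R)"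
  by (rule indexed_pset.indexed_const)

lemma pset_carrier_coeff: "p \<in> indexed_pset I (carrier R) \<Longrightarrow> carrier_coeff p"
  by (rule indexed_pset_in_carrier[OF subset_refl])

lemma smult_in_pset:
  assumes "q \<in> indexed_pset I (carrier R)" "k \<in> carrier R"
  shows "(\<lambda>m. k \<otimes> q m) \<in> indexed_pset I (carrier R)"
  using assms(1)
proof (induction rule: indexed_pset.induct)
  case (indexed_const k')
  have "(\<lambda>m. k \<otimes> indexed_const k' m) = indexed_const (k \<otimes> k')"
    using assms(2) by (auto simp: indexed_const_def)
  moreover have "indexed_const (k \<otimes> k') \<in> indexed_pset I (carrier R)"
    using indexed_const assms(2) by (intro indexed_const_in_pset m_closed)
  ultimately show ?case by metis
next
  case (indexed_padd p q)
  have "(\<lambda>m. k \<otimes> indexed_padd p q m) = indexed_padd (\<lambda>m. k \<otimes> p m) (\<lambda>m. k \<otimes> q m)"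
    using indexed_padd assms(2) by (auto simp: indexed_padd_def r_distr coeffs_closed)
  then show ?case using indexed_pset.indexed_padd[OF indexed_padd.IH] by simp
next
  case (indexed_pmult p i)
  have "(\<lambda>m. k \<otimes> indexed_pmult p i m) = indexed_pmult (\<lambda>m. k \<otimes> p m) i"
    using assms(2) by (auto simp: indexed_pmult_def)
  then show ?case using indexed_pset.indexed_pmult[OF indexed_pmult.IH indexed_pmult.hyps(2)] by simp
qed

lemma indexed_mult_in_pset:
  assumes "p \<in> indexed_pset I (carrier R)" "q \<in> indexed_pset I (carrier R)"
  shows "indexed_mult p q \<in> indexed_pset I (carrier R)"
  using assms(1)
proof (induction rule: indexed_pset.induct)
  case (indexed_const k)
  then show ?case
    using smult_in_pset[OF assms(2)] indexed_mult_const_left[OF _ pset_carrier_coeff[OF assms(2)]]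
    by simp
next
  case (indexed_padd p p')
  have "indexed_mult (indexed_padd p p') q = indexed_padd (indexed_mult p q) (indexed_mult p' q)"
    by (rule indexed_mult_padd_left) (rule pset_carrier_coeff, fact)+
  then show ?case using indexed_pset.indexed_padd[OF indexed_padd.IH] by simp
next
  case (indexed_pmult p i)
  have "indexed_mult (indexed_pmult p i) q = indexed_pmult (indexed_mult p q) i"
    by (rule indexed_mult_pmult_left) (rule pset_carrier_coeff, fact)+
  then show ?case using indexed_pset.indexed_pmult[OF indexed_pmult.IH indexed_pmult.hyps(2)] by simp
qed

text \<open>Induction on the construction of \<open>p\<close> from constants, sums and
  multiplications by a variable replaces a rearrangement of triple sums: each construction step
  moves out of both sides.\<close>

lemma indexed_mult_assoc:
  assumes "p \<in> indexed_pset I (carrier R)" "carrier_coeff q" "carrier_coeff r"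
  shows "indexed_mult (indexed_mult p q) r = indexed_mult p (indexed_mult q r)"
  using assms(1)
proof (induction rule: indexed_pset.induct)
  case (indexed_const k)
  note c = assms(2,3)[THEN carrier_coeffE]
  have qr: "carrier_coeff (indexed_mult q r)" by (rule indexed_mult_in_carrier[OF assms(2,3)])
  have "indexed_mult (\<lambda>m. k \<otimes> q m) r m = k \<otimes> indexed_mult q r m" for m
  proof -
    have "finsum R (\<lambda>ab. (k \<otimes> q (fst ab)) \<otimes> r (snd ab)) (mset_splits m) =
        finsum R (\<lambda>ab. k \<otimes> (q (fst ab) \<otimes> r (snd ab))) (mset_splits m)"
      by (rule finsum_cong') (use c indexed_const in \<open>auto simp: m_assoc\<close>)
    also have "\<dots> = k \<otimes> finsum R (\<lambda>ab. q (fst ab) \<otimes> r (snd ab)) (mset_splits m)"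
      by (rule finsum_rdistr[symmetric, OF finite_mset_splits indexed_const]) (use c in auto)
    finally show ?thesis by (simp add: indexed_mult_def)
  qed
  then show ?case
    by (simp add: indexed_mult_const_left[OF indexed_const assms(2)]
        indexed_mult_const_left[OF indexed_const qr])
next
  case (indexed_padd p p')
  note pc = indexed_padd.hyps[THEN pset_carrier_coeff]
  show ?case
    using indexed_padd.IH pc assms(2,3)
    by (simp add: indexed_mult_padd_left indexed_mult_in_carrier)
next
  case (indexed_pmult p i)
  note pc = indexed_pmult.hyps(1)[THEN pset_carrier_coeff]
  show ?case
    using indexed_pmult.IH pc assms(2,3)
    by (simp add: indexed_mult_pmult_left indexed_mult_in_carrier)
qed

lemma indexed_poly_ring_simps:
  "carrier (indexed_poly_ring R I) = indexed_pset I (carrier R)"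
  "x \<otimes>\<^bsub>indexed_poly_ring R I\<^esub> y = indexed_mult x y"
  "\<one>\<^bsub>indexed_poly_ring R I\<^esub> = indexed_const \<one>"
  "\<zero>\<^bsub>indexed_poly_ring R I\<^esub> = indexed_const \<zero>"
  "x \<oplus>\<^bsub>indexed_poly_ring R I\<^esub> y = indexed_padd x y"
  by (simp_all add: indexed_poly_ring_def indexed_mult_def mset_splits_def)

lemma indexed_padd_comm:
  assumes "carrier_coeff p" "carrier_coeff q"
  shows "indexed_padd p q = indexed_padd q p"
  using assms by (auto simp: indexed_padd_def carrier_coeff_def a_comm)

lemma indexed_padd_assoc:
  assumes "carrier_coeff p" "carrier_coeff q" "carrier_coeff r"
  shows "indexed_padd (indexed_padd p q) r = indexed_padd p (indexed_padd q r)"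
  using assms by (auto simp: indexed_padd_def carrier_coeff_def a_assoc)

lemma cring_indexed_poly_ring: "cring (indexed_poly_ring R I)"
proof (rule cringI)
  show "abelian_group (indexed_poly_ring R I)"
  proof (rule abelian_groupI, unfold indexed_poly_ring_simps)
    fix x y z assume x: "x \<in> indexed_pset I (carrier R)"
    note xc = pset_carrier_coeff[OF x]
    show "indexed_padd (indexed_const \<zero>) x = x" by (rule indexed_padd_zero(2)[OF xc])
    \<comment> \<open>The negative is taken as a scalar multiple because \<open>indexed_pset\<close>
      is known to be closed under those.\<close>
    let ?y = "\<lambda>m. \<ominus> \<one> \<otimes> x m"
    have "?y \<in> indexed_pset I (carrier R)" by (rule smult_in_pset[OF x]) simp
    moreover have "indexed_padd ?y x = indexed_const \<zero>"
      unfolding indexed_zero_def using coeffs_closed[OF x] by (simp add: indexed_padd_def l_minus l_neg)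
    ultimately show "\<exists>y\<in>indexed_pset I (carrier R). indexed_padd y x = indexed_const \<zero>" by blast
    assume y: "y \<in> indexed_pset I (carrier R)"
    note yc = pset_carrier_coeff[OF y]
    show "indexed_padd x y \<in> indexed_pset I (carrier R)" using x y by (rule indexed_pset.indexed_padd)
    show "indexed_padd x y = indexed_padd y x" by (rule indexed_padd_comm[OF xc yc])
    assume z: "z \<in> indexed_pset I (carrier R)"
    show "indexed_padd (indexed_padd x y) z = indexed_padd x (indexed_padd y z)"
      by (rule indexed_padd_assoc[OF xc yc pset_carrier_coeff[OF z]])
  qed (simp add: indexed_const_in_pset)
  show "comm_monoid (indexed_poly_ring R I)"
  proof (rule comm_monoidI, unfold indexed_poly_ring_simps)
    fix x y z assume x: "x \<in> indexed_pset I (carrier R)"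
    note xc = pset_carrier_coeff[OF x]
    show "indexed_mult (indexed_const \<one>) x = x"
      using coeffs_closed[OF x] by (simp add: indexed_mult_const_left[OF one_closed xc])
    assume y: "y \<in> indexed_pset I (carrier R)"
    note yc = pset_carrier_coeff[OF y]
    show "indexed_mult x y \<in> indexed_pset I (carrier R)" by (rule indexed_mult_in_pset[OF x y])
    show "indexed_mult x y = indexed_mult y x" by (rule indexed_mult_comm[OF xc yc])
    assume z: "z \<in> indexed_pset I (carrier R)"
    show "indexed_mult (indexed_mult x y) z = indexed_mult x (indexed_mult y z)"
      by (rule indexed_mult_assoc[OF x yc pset_carrier_coeff[OF z]])
  qed (simp add: indexed_const_in_pset)
  fix x y z
  assume "x \<in> carrier (indexed_poly_ring R I)" "y \<in> carrier (indexed_poly_ring R I)"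
    "z \<in> carrier (indexed_poly_ring R I)"
  then show "(x \<oplus>\<^bsub>indexed_poly_ring R I\<^esub> y) \<otimes>\<^bsub>indexed_poly_ring R I\<^esub> z =
      (x \<otimes>\<^bsub>indexed_poly_ring R I\<^esub> z) \<oplus>\<^bsub>indexed_poly_ring R I\<^esub> (y \<otimes>\<^bsub>indexed_poly_ring R I\<^esub> z)"
    unfolding indexed_poly_ring_simps
    by (intro indexed_mult_padd_left pset_carrier_coeff)
qed

section \<open>Changing the set of indeterminates\<close>

lemma indexed_pset_mono:
  assumes "I \<subseteq> J"
  shows "indexed_pset I K \<subseteq> indexed_pset J K"
proof
  fix p assume "p \<in> indexed_pset I K"
  then show "p \<in> indexed_pset J K"
    by (induction rule: indexed_pset.induct) (use assms in \<open>auto intro: indexed_pset.intros\<close>)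
qed

lemma indexed_poly_ring_inclusion:
  assumes "I \<subseteq> J"
  shows "ring_hom_cring (indexed_poly_ring R I) (indexed_poly_ring R J) id"
proof (rule ring_hom_cringI[OF cring_indexed_poly_ring cring_indexed_poly_ring])
  show "id \<in> ring_hom (indexed_poly_ring R I) (indexed_poly_ring R J)"
    using indexed_pset_mono[OF assms, of "carrier R"]
    by (intro ring_hom_memI) (auto simp: indexed_poly_ring_simps)
qed

text \<open>The construction of a polynomial multiplies by a variable only finitely often.\<close>

lemma indexed_pset_finite_support:
  assumes "p \<in> indexed_pset I K"
  shows "\<exists>J. finite J \<and> J \<subseteq> I \<and> p \<in> indexed_pset J K"
  using assms
proof (induction rule: indexed_pset.induct)
  case (indexed_const k)
  then show ?case by (intro exI[of _ "{}"]) (simp add: indexed_pset.indexed_const)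
next
  case (indexed_padd p q)
  then obtain J J' where J: "finite J" "J \<subseteq> I" "p \<in> indexed_pset J K"
    "finite J'" "J' \<subseteq> I" "q \<in> indexed_pset J' K" by blast
  then have "p \<in> indexed_pset (J \<union> J') K" "q \<in> indexed_pset (J \<union> J') K"
    using indexed_pset_mono[of J "J \<union> J'" K] indexed_pset_mono[of J' "J \<union> J'" K] by auto
  then have "indexed_padd p q \<in> indexed_pset (J \<union> J') K" by (rule indexed_pset.indexed_padd)
  then show ?case using J by (intro exI[of _ "J \<union> J'"]) simp
next
  case (indexed_pmult p i)
  then obtain J where J: "finite J" "J \<subseteq> I" "p \<in> indexed_pset J K" by blast
  then have "p \<in> indexed_pset (insert i J) K" using indexed_pset_mono[of J "insert i J" K] by auto
  then have "indexed_pmult p i \<in> indexed_pset (insert i J) K" by (rule indexed_pset.indexed_pmult) simp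
  then show ?case using J indexed_pmult.hyps(2) by (intro exI[of _ "insert i J"]) simp
qed

lemma indexed_pset_finite_support_set:
  assumes "finite F" "F \<subseteq> indexed_pset I K"
  shows "\<exists>J. finite J \<and> J \<subseteq> I \<and> F \<subseteq> indexed_pset J K"
  using assms
proof (induction F rule: finite_induct)
  case empty
  then show ?case by (intro exI[of _ "{}"]) simp
next
  case (insert p F)
  then obtain J where J: "finite J" "J \<subseteq> I" "F \<subseteq> indexed_pset J K" by auto
  obtain J' where J': "finite J'" "J' \<subseteq> I" "p \<in> indexed_pset J' K"
    using indexed_pset_finite_support[of p I K] insert.prems by auto
  have "insert p F \<subseteq> indexed_pset (J \<union> J') K"
    using J(3) J'(3) indexed_pset_mono[of J "J \<union> J'" K] indexed_pset_mono[of J' "J \<union> J'" K] by auto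
  then show ?case using J J' by (intro exI[of _ "J \<union> J'"]) simp
qed

lemma indexed_pset_index_free:
  assumes "p \<in> indexed_pset I (carrier R)" "v \<notin> I"
  shows "v \<in># m \<Longrightarrow> p m = \<zero>"
  using assms(1)
proof (induction arbitrary: m rule: indexed_pset.induct)
  case (indexed_const k)
  then show ?case by (auto simp: indexed_const_def)
next
  case (indexed_padd p q)
  then show ?case by (simp add: indexed_padd_def)
next
  case (indexed_pmult p i)
  have "v \<noteq> i" using assms(2) indexed_pmult.hyps(2) by blast
  then have "v \<in># m - {#i#}" using indexed_pmult.prems by (simp add: in_diff_count)
  then show ?case using indexed_pmult.IH by (simp add: indexed_pmult_def)
qed

section \<open>One more variable, compared with univariate polynomials\<close>

lemma indexed_var_in_pset: "i \<in> I \<Longrightarrow> indexed_var i \<in> indexed_pset I (carrier R)"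
  unfolding indexed_var_def by (intro indexed_pset.intros) simp_all

text \<open>This turns the constructor \<open>indexed_pmult\<close> into a product of ring elements,
  so that inductions over \<open>indexed_pset\<close> can use homomorphisms.\<close>

lemma indexed_mult_var_right:
  assumes "carrier_coeff p"
  shows "indexed_mult p (indexed_var i) = indexed_pmult p i"
proof -
  have one: "carrier_coeff (indexed_const \<one>)"
    by (rule pset_carrier_coeff[OF indexed_const_in_pset[OF one_closed]])
  then have var: "carrier_coeff (indexed_var i)"
    unfolding indexed_var_def by (rule indexed_pmult_in_carrier)
  have "indexed_mult p (indexed_var i) = indexed_mult (indexed_var i) p"
    by (rule indexed_mult_comm[OF assms var])
  also have "\<dots> = indexed_pmult (\<lambda>m. \<one> \<otimes> p m) i"
    unfolding indexed_var_def
    by (simp only: indexed_mult_pmult_left[OF one assms] indexed_mult_const_left[OF one_closed assms])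
  also have "(\<lambda>m. \<one> \<otimes> p m) = p" using carrier_coeffE[OF assms] by simp
  finally show ?thesis .
qed

lemma indexed_finsum_eval:
  assumes "finite A" "g \<in> A \<rightarrow> indexed_pset I (carrier R)"
  shows "finsum (indexed_poly_ring R I) g A m = finsum R (\<lambda>i. g i m) A"
  using assms
proof (induction A rule: finite_induct)
  interpret B: cring "indexed_poly_ring R I" by (rule cring_indexed_poly_ring)
  case empty
  then show ?case by (simp add: indexed_poly_ring_simps indexed_const_def)
next
  interpret B: cring "indexed_poly_ring R I" by (rule cring_indexed_poly_ring)
  case (insert x A)
  have gx: "g x \<in> indexed_pset I (carrier R)" and gA: "g \<in> A \<rightarrow> indexed_pset I (carrier R)"
    using insert.prems by auto
  have "finsum (indexed_poly_ring R I) g (insert x A) =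
      indexed_padd (g x) (finsum (indexed_poly_ring R I) g A)"
    using B.finsum_insert[OF insert.hyps, of g] gx gA by (simp add: indexed_poly_ring_simps)
  moreover have "finsum R (\<lambda>i. g i m) (insert x A) = g x m \<oplus> finsum R (\<lambda>i. g i m) A"
    by (rule finsum_insert[OF insert.hyps]) (use gx gA coeffs_closed in auto)
  ultimately show ?case using insert.IH[OF gA] by (simp add: indexed_padd_def)
qed

text \<open>Every monomial is \<open>m + replicate_mset j v\<close> for exactly one \<open>m\<close>
  without \<open>v\<close> and one \<open>j\<close>. In these coordinates multiplication by a power
  of the variable is a shift of \<open>j\<close>; \<open>p\<close> itself may involve
  \<open>v\<close>.\<close>

lemma indexed_mult_var_pow_eval:
  fixes m :: "'c multiset"
  assumes p: "p \<in> indexed_pset I (carrier R)" and v: "v \<in> I" "v \<notin># m"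
  shows "indexed_mult p (indexed_var v [^]\<^bsub>indexed_poly_ring R I\<^esub> n) (m + replicate_mset j v) =
    (if n \<le> j then p (m + replicate_mset (j - n) v) else \<zero>)"
proof (induction n arbitrary: j)
  interpret B: cring "indexed_poly_ring R I" by (rule cring_indexed_poly_ring)
  case 0
  have "p \<otimes>\<^bsub>indexed_poly_ring R I\<^esub> \<one>\<^bsub>indexed_poly_ring R I\<^esub> = p"
    using p by (intro B.r_one) (simp add: indexed_poly_ring_simps)
  then show ?case by (simp add: indexed_poly_ring_simps)
next
  interpret B: cring "indexed_poly_ring R I" by (rule cring_indexed_poly_ring)
  case (Suc n)
  let ?s = "indexed_var v"
  let ?q = "indexed_mult p (?s [^]\<^bsub>indexed_poly_ring R I\<^esub> n)"
  have s: "?s \<in> carrier (indexed_poly_ring R I)"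
    using indexed_var_in_pset[OF v(1)] by (simp add: indexed_poly_ring_simps)
  have pc: "p \<in> carrier (indexed_poly_ring R I)" using p by (simp add: indexed_poly_ring_simps)
  have q: "?q \<in> carrier (indexed_poly_ring R I)"
    using B.m_closed[OF pc B.nat_pow_closed[OF s]] by (simp add: indexed_poly_ring_simps)
  have "indexed_mult p (?s [^]\<^bsub>indexed_poly_ring R I\<^esub> Suc n) = indexed_mult ?q ?s"
    using B.m_assoc[OF pc B.nat_pow_closed[OF s] s] by (simp add: indexed_poly_ring_simps)
  also have "\<dots> = indexed_pmult ?q v"
    by (rule indexed_mult_var_right[OF pset_carrier_coeff]) (use q in \<open>simp add: indexed_poly_ring_simps\<close>)
  finally have eq: "indexed_mult p (?s [^]\<^bsub>indexed_poly_ring R I\<^esub> Suc n) = indexed_pmult ?q v" .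
  show ?case
  proof (cases j)
    case 0
    then show ?thesis unfolding eq using v(2) by (simp add: indexed_pmult_def)
  next
    case (Suc k)
    then show ?thesis unfolding eq using Suc.IH[of k] by (simp add: indexed_pmult_def)
  qed
qed

text \<open>Evaluation at the new variable regroups polynomials by powers of \<open>v\<close>. The
  third claim identifies its restriction to constants with the inclusion of \<open>K\<close> in
  \<open>L\<close>, through which prime extension along the constants becomes prime extension along
  \<open>id\<close>.\<close>

lemma adjoin_variable:
  fixes I :: "'c set"
  assumes v: "v \<notin> I"
  defines "K \<equiv> indexed_poly_ring R I" and "L \<equiv> indexed_poly_ring R (insert v I)"
  defines "\<phi> \<equiv> UnivPoly.eval K L id (indexed_var v)"
  shows "ring_hom_cring (UP K) L \<phi>" "bij_betw \<phi> (carrier (UP K)) (carrier L)"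
    "\<And>x. x \<in> carrier K \<Longrightarrow> \<phi> (up_ring.monom (UP K) x 0) = x"
proof -
  let ?s = "indexed_var v :: 'c multiset \<Rightarrow> 'a"
  have incl: "ring_hom_cring K L id"
    unfolding K_def L_def by (rule indexed_poly_ring_inclusion) blast
  interpret i: ring_hom_cring K L id by (rule incl)
  interpret U: UP_pre_univ_prop K L id "UP K"
    by (rule UP_pre_univ_propI[OF i.R.is_cring i.S.is_cring i.homh])
  have carr: "carrier K = indexed_pset I (carrier R)"
    "carrier L = indexed_pset (insert v I) (carrier R)"
    by (simp_all add: K_def L_def indexed_poly_ring_simps)
  have s: "?s \<in> carrier L" unfolding carr by (rule indexed_var_in_pset) simp
  have hom: "\<phi> \<in> ring_hom (UP K) L" unfolding \<phi>_def by (rule U.eval_ring_hom[OF s])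
  then show "ring_hom_cring (UP K) L \<phi>" by (rule ring_hom_cringI[OF U.UP_cring i.S.is_cring])
  then interpret f: ring_hom_cring "UP K" L \<phi> .
  show const: "\<phi> (up_ring.monom (UP K) x 0) = x" if "x \<in> carrier K" for x
    unfolding \<phi>_def using U.eval_const[OF s that] by simp
  \<comment> \<open>This reads off all coefficients of \<open>p\<close> at monomials without
    \<open>v\<close>. At monomials with \<open>v\<close> they are zero, being coefficients of
    polynomials over \<open>I\<close>, so injectivity follows.\<close>
  have coeff_eval: "\<phi> p (m + replicate_mset j v) = up_ring.coeff (UP K) p j m"
    if p: "p \<in> carrier (UP K)" and m: "v \<notin># m" for p m j
  proof -
    let ?a = "up_ring.coeff (UP K) p"
    let ?g = "\<lambda>i. ?a i \<otimes>\<^bsub>L\<^esub> ?s [^]\<^bsub>L\<^esub> i"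
    let ?d = "deg K p"
    have aK: "?a i \<in> carrier K" for i using p by (rule U.coeff_closed)
    have aL: "?a i \<in> carrier L" for i using i.hom_closed[OF aK] by simp
    have g: "?g i \<in> carrier L" for i using aL s by simp
    have a_m: "?a i n \<in> carrier R" for i n using aK[of i] unfolding carr by (rule coeffs_closed)
    \<comment> \<open>For \<open>i > j\<close> the power of \<open>v\<close> does not divide the
      monomial. For \<open>i < j\<close> the quotient monomial still contains \<open>v\<close>,
      which does not occur in \<open>?a i\<close>.\<close>
    have summand: "?g i (m + replicate_mset j v) = (if j = i then ?a i m else \<zero>)" for i
    proof -
      have "?g i (m + replicate_mset j v) = (if i \<le> j then ?a i (m + replicate_mset (j - i) v) else \<zero>)"
        using indexed_mult_var_pow_eval[of "?a i" "insert v I" v m i j] aL[of i] m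
        unfolding carr by (simp add: L_def indexed_poly_ring_simps)
      moreover have "?a i (m + replicate_mset (j - i) v) = \<zero>" if "i < j"
        using aK[of i] that unfolding carr by (intro indexed_pset_index_free[OF _ v]) auto
      ultimately show ?thesis by auto
    qed
    have "\<phi> p = finsum L ?g {..?d}"
      unfolding \<phi>_def using U.eval_on_carrier[OF p, of L id ?s] by simp
    then have "\<phi> p (m + replicate_mset j v) = finsum R (\<lambda>i. if j = i then ?a i m else \<zero>) {..?d}"
      using indexed_finsum_eval[of "{..?d}" ?g "insert v I" "m + replicate_mset j v"] g
      unfolding carr by (simp add: summand flip: L_def)
    also have "\<dots> = ?a j m"
    proof (cases "j \<le> ?d")
      case True
      then show ?thesis by (intro finsum_singleton) (use a_m in auto)
    next
      case False
      then have "?a j = \<zero>\<^bsub>K\<^esub>" using p by (intro U.deg_aboveD) simp_all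
      then have "?a j m = \<zero>" by (simp add: K_def indexed_poly_ring_simps indexed_const_def)
      moreover have "finsum R (\<lambda>i. if j = i then ?a i m else \<zero>) {..?d} = \<zero>"
        by (rule add.finprod_one_eqI) (use False in auto)
      ultimately show ?thesis by simp
    qed
    finally show ?thesis .
  qed
  have "inj_on \<phi> (carrier (UP K))"
  proof (rule inj_onI)
    fix p q assume p: "p \<in> carrier (UP K)" and q: "q \<in> carrier (UP K)" and eq: "\<phi> p = \<phi> q"
    show "p = q"
    proof (rule U.up_eqI[OF _ p q], rule ext)
      fix j m
      show "up_ring.coeff (UP K) p j m = up_ring.coeff (UP K) q j m"
      proof (cases "v \<in># m")
        case True
        have "up_ring.coeff (UP K) r j m = \<zero>" if "r \<in> carrier (UP K)" for r
          using U.coeff_closed[OF that, of j] unfolding carr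
          by (rule indexed_pset_index_free[OF _ v True])
        then show ?thesis using p q by simp
      next
        case False
        then show ?thesis using coeff_eval[OF p] coeff_eval[OF q] eq by metis
      qed
    qed
  qed
  moreover have "\<phi> ` carrier (UP K) = carrier L"
  proof
    show "\<phi> ` carrier (UP K) \<subseteq> carrier L" by auto
    show "carrier L \<subseteq> \<phi> ` carrier (UP K)"
    proof
      have K_image: "x \<in> \<phi> ` carrier (UP K)" if "x \<in> carrier K" for x
        using const[OF that] U.monom_closed[OF that, of 0] by (metis imageI)
      have var_image: "indexed_var i \<in> \<phi> ` carrier (UP K)" if "i \<in> insert v I" for i
      proof (cases "i = v")
        case True
        have "\<phi> (up_ring.monom (UP K) \<one>\<^bsub>K\<^esub> 1) = ?s" unfolding \<phi>_def by (rule U.eval_monom1[OF s])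
        moreover have "up_ring.monom (UP K) \<one>\<^bsub>K\<^esub> 1 \<in> carrier (UP K)" by simp
        ultimately show ?thesis unfolding True by (metis imageI)
      next
        case False
        then show ?thesis
          using that by (intro K_image) (auto simp: carr intro: indexed_var_in_pset)
      qed
      fix q assume "q \<in> carrier L"
      then have "q \<in> indexed_pset (insert v I) (carrier R)" by (simp only: carr)
      then show "q \<in> \<phi> ` carrier (UP K)"
      proof (induction rule: indexed_pset.induct)
        case (indexed_const k)
        then show ?case by (intro K_image) (simp add: carr indexed_const_in_pset)
      next
        case (indexed_padd p q)
        then obtain a b where ab: "a \<in> carrier (UP K)" "b \<in> carrier (UP K)" "p = \<phi> a" "q = \<phi> b"
          by blast
        have "indexed_padd p q = \<phi> (a \<oplus>\<^bsub>UP K\<^esub> b)"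
          unfolding f.hom_add[OF ab(1,2)] ab(3,4) by (simp add: L_def indexed_poly_ring_simps)
        then show ?case using U.P.a_closed[OF ab(1,2)] by (metis imageI)
      next
        case (indexed_pmult p i)
        then obtain a b where ab: "a \<in> carrier (UP K)" "b \<in> carrier (UP K)" "p = \<phi> a"
          "indexed_var i = \<phi> b" using var_image[of i] by blast
        have "indexed_pmult p i = indexed_mult p (indexed_var i)"
          by (rule indexed_mult_var_right[symmetric, OF pset_carrier_coeff[OF indexed_pmult.hyps(1)]])
        also have "\<dots> = \<phi> (a \<otimes>\<^bsub>UP K\<^esub> b)"
          unfolding f.hom_mult[OF ab(1,2)] ab(3,4) by (simp add: L_def indexed_poly_ring_simps)
        finally show ?case using U.P.m_closed[OF ab(1,2)] by (metis imageI)
      qed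
    qed
  qed
  ultimately show "bij_betw \<phi> (carrier (UP K)) (carrier L)" by (simp add: bij_betw_def)
qed

section \<open>Adjoining finitely many and arbitrarily many variables\<close>

lemma fgfc_ring_adjoin_variable:
  assumes "fgfc_ring (indexed_poly_ring R I)" "v \<notin> I"
  shows "fgfc_ring (indexed_poly_ring R (insert v I))"
proof -
  interpret K: UP_cring "indexed_poly_ring R I" "UP (indexed_poly_ring R I)"
    by (rule UP_cring.intro[OF cring_indexed_poly_ring])
  show ?thesis
    by (rule fgfc_ring_iso[OF K.fgfc_ring_UP[OF assms(1)] adjoin_variable(1,2)[OF assms(2)]])
qed

lemma extends_primes_adjoin_variable:
  assumes "v \<notin> I"
  shows "extends_primes (indexed_poly_ring R I) (indexed_poly_ring R (insert v I)) id"
proof -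
  interpret K: UP_cring "indexed_poly_ring R I" "UP (indexed_poly_ring R I)"
    by (rule UP_cring.intro[OF cring_indexed_poly_ring])
  show ?thesis
  proof (rule extends_primes_comp[OF K.extends_primes_const])
    show "extends_primes (UP (indexed_poly_ring R I)) (indexed_poly_ring R (insert v I))
        (UnivPoly.eval (indexed_poly_ring R I) (indexed_poly_ring R (insert v I)) id (indexed_var v))"
      by (rule extends_primes_iso[OF adjoin_variable(1,2)[OF assms]])
    show "ring_hom_cring (indexed_poly_ring R I) (indexed_poly_ring R (insert v I)) id"
      by (rule indexed_poly_ring_inclusion) blast
  qed (simp add: adjoin_variable(3)[OF assms])
qed

lemma extends_primes_finite_variables:
  assumes "finite D"
  shows "extends_primes (indexed_poly_ring R I) (indexed_poly_ring R (I \<union> D)) id"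
  using assms
proof (induction D rule: finite_induct)
  case empty
  have "ring_hom_cring (indexed_poly_ring R I) (indexed_poly_ring R I) id"
    by (rule indexed_poly_ring_inclusion) simp
  then show ?case unfolding Un_empty_right by (rule extends_primes_iso[OF _ bij_betw_id])
next
  case (insert v D)
  show ?case
  proof (cases "v \<in> I")
    \<comment> \<open>\<open>D\<close> may overlap \<open>I\<close>. The passage to infinitely many
      variables uses all finite subsets of the larger index set, including such
      \<open>D\<close>.\<close>
    case True
    then show ?thesis using insert.IH by (simp add: insert_absorb)
  next
    case False
    then have "extends_primes (indexed_poly_ring R (I \<union> D)) (indexed_poly_ring R (insert v (I \<union> D))) id"
      using insert.hyps(2) by (intro extends_primes_adjoin_variable) simp
    then have "extends_primes (indexed_poly_ring R I) (indexed_poly_ring R (insert v (I \<union> D))) id"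
      by (rule extends_primes_comp[OF insert.IH]) (rule indexed_poly_ring_inclusion, auto)
    then show ?thesis unfolding Un_insert_right .
  qed
qed

lemma fgfc_ring_finite_variables:
  assumes "fgfc_ring R" "finite I"
  shows "fgfc_ring (indexed_poly_ring R I)"
  using assms(2)
proof (induction I rule: finite_induct)
  case empty
  \<comment> \<open>Without variables the polynomials are still functions on multisets, so the base
    case is an isomorphism with \<open>R\<close> and not an equality.\<close>
  let ?B = "indexed_poly_ring R ({} :: 'c set)"
  show ?case
  proof (rule fgfc_ring_iso[OF assms(1)])
    show "ring_hom_cring R ?B indexed_const"
    proof (rule ring_hom_cringI[OF is_cring cring_indexed_poly_ring ring_hom_memI])
      fix x y assume xy: "x \<in> carrier R" "y \<in> carrier R"
      have yc: "carrier_coeff (indexed_const y)"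
        by (rule pset_carrier_coeff[OF indexed_const_in_pset[OF xy(2)]])
      have "indexed_const (x \<otimes> y) = (\<lambda>m. x \<otimes> indexed_const y m)"
        using xy by (auto simp: indexed_const_def)
      then show "indexed_const (x \<otimes> y) = indexed_const x \<otimes>\<^bsub>?B\<^esub> indexed_const y"
        by (simp only: indexed_poly_ring_simps indexed_mult_const_left[OF xy(1) yc])
    qed (simp_all add: indexed_poly_ring_simps indexed_const_in_pset indexed_padd_const)
    have "p \<in> indexed_const ` carrier R" if "p \<in> indexed_pset {} (carrier R)" for p :: "'c multiset \<Rightarrow> 'a"
      using that by (induction rule: indexed_pset.induct) (auto simp: indexed_padd_const)
    moreover have "inj_on indexed_const (carrier R)"
      by (rule inj_onI) (metis indexed_const_def)
    ultimately show "bij_betw indexed_const (carrier R) (carrier ?B)"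
      by (auto simp: bij_betw_def indexed_poly_ring_simps indexed_const_in_pset)
  qed
next
  case (insert v I)
  then show ?case by (intro fgfc_ring_adjoin_variable)
qed

text \<open>Over infinitely many variables the extension of a prime is the directed union of its
  extensions to the subrings with finitely many additional variables.\<close>

lemma extends_primes_variables:
  assumes sub: "I \<subseteq> J"
  shows "extends_primes (indexed_poly_ring R I) (indexed_poly_ring R J) id"
  unfolding extends_primes_def
proof (intro conjI allI impI indexed_poly_ring_inclusion[OF sub])
  let ?B = "indexed_poly_ring R"
  fix P assume P: "primeideal P (?B I)"
  interpret J: cring "?B J" by (rule cring_indexed_poly_ring)
  have "\<exists>E. primeideal E (?B (I \<union> D)) \<and> contraction (?B I) id E = P \<and>
      (\<forall>Q. ideal Q (?B (I \<union> D)) \<and> id ` P \<subseteq> Q \<longrightarrow> E \<subseteq> Q)" if "finite D" for D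
    using extends_primes_finite_variables[OF that, of I] P unfolding extends_primes_def by blast
  \<comment> \<open>One extension is chosen for each finite \<open>D\<close>. No compatibility has
    to be demanded of the choices: leastness makes them increase with \<open>D\<close>, as
    \<open>mono\<close> shows.\<close>
  then obtain E where E: "\<forall>D. finite D \<longrightarrow> primeideal (E D) (?B (I \<union> D)) \<and>
      contraction (?B I) id (E D) = P \<and>
      (\<forall>Q. ideal Q (?B (I \<union> D)) \<and> id ` P \<subseteq> Q \<longrightarrow> E D \<subseteq> Q)" by metis
  have prime: "primeideal (E D) (?B (I \<union> D))" if "finite D" for D using E that by blast
  have contr: "x \<in> P \<longleftrightarrow> x \<in> carrier (?B I) \<and> x \<in> E D" if "finite D" for D x
  proof -
    have "contraction (?B I) id (E D) = P" using E that by blast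
    then show ?thesis using mem_contraction_iff[of x "?B I" id "E D"] by simp
  qed
  have least: "E D \<subseteq> Q" if "finite D" "ideal Q (?B (I \<union> D))" "P \<subseteq> Q" for D Q
    using E that by (metis image_id id_apply)
  \<comment> \<open>Leastness of \<open>E D\<close> concerns ideals of its own ring; contracting
    \<open>Q\<close> extends it to ideals of larger rings.\<close>
  have E_subset: "E D \<subseteq> Q" if D: "finite D" "I \<union> D \<subseteq> S" and Q: "ideal Q (?B S)" "P \<subseteq> Q" for D S Q
  proof -
    interpret h: ring_hom_cring "?B (I \<union> D)" "?B S" id by (rule indexed_poly_ring_inclusion[OF D(2)])
    let ?Q = "contraction (?B (I \<union> D)) id Q"
    have "P \<subseteq> carrier (?B (I \<union> D))"
      using contr[of "{}"] indexed_pset_mono[of I "I \<union> D" "carrier R"]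
      by (auto simp: indexed_poly_ring_simps)
    then have "P \<subseteq> ?Q" using Q(2) mem_contraction_iff[of _ _ id Q] by auto
    then have "E D \<subseteq> ?Q" by (rule least[OF D(1) h.ideal_contraction[OF Q(1)]])
    then show ?thesis using mem_contraction_iff[of _ _ id Q] by auto
  qed
  have mono: "E D \<subseteq> E D'" if "finite D'" "D \<subseteq> D'" for D D'
  proof (rule E_subset)
    show "finite D" using that finite_subset by blast
    show "ideal (E D') (?B (I \<union> D'))" using prime[OF that(1)] by (rule primeideal.axioms(1))
  qed (use that contr[of D'] in auto)
  define U where "U = \<Union> (E ` {D. finite D \<and> D \<subseteq> J})"
  have U_I: "x \<in> U" if "finite D" "D \<subseteq> J" "x \<in> E D" for x D using that by (auto simp: U_def)
  have U_E: "\<exists>D. finite D \<and> D \<subseteq> J \<and> x \<in> E D" if "x \<in> U" for x using that by (auto simp: U_def)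
  have sub_D: "carrier (?B (I \<union> D)) \<subseteq> carrier (?B J)" if "D \<subseteq> J" for D
    using indexed_pset_mono[of "I \<union> D" J "carrier R"] sub that by (simp add: indexed_poly_ring_simps)
  \<comment> \<open>A product may lie in \<open>E D\<close> although its factors involve variables
    outside \<open>I \<union> D\<close>. Primality can be used only after enlarging \<open>D\<close>
    to a finite set that accommodates both factors.\<close>
  have common: "\<exists>D. finite D \<and> D \<subseteq> J \<and> C \<subseteq> D \<and> x \<in> carrier (?B (I \<union> D)) \<and> y \<in> carrier (?B (I \<union> D))"
    if xy: "x \<in> carrier (?B J)" "y \<in> carrier (?B J)" and C: "finite C" "C \<subseteq> J" for x y C
  proof -
    have "{x, y} \<subseteq> indexed_pset J (carrier R)" using xy by (simp add: indexed_poly_ring_simps)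
    then obtain D where D: "finite D" "D \<subseteq> J" "{x, y} \<subseteq> indexed_pset D (carrier R)"
      using indexed_pset_finite_support_set[of "{x, y}" J "carrier R"] by auto
    have "indexed_pset D (carrier R) \<subseteq> indexed_pset (I \<union> (C \<union> D)) (carrier R)"
      by (rule indexed_pset_mono) blast
    then show ?thesis
      using D C by (intro exI[of _ "C \<union> D"]) (auto simp: indexed_poly_ring_simps)
  qed
  have ideal: "ideal (E D) (?B (I \<union> D))" if "finite D" for D
    using prime[OF that] by (rule primeideal.axioms(1))
  have U_carrier: "x \<in> carrier (?B J)" if x: "x \<in> U" for x
  proof -
    obtain D where D: "finite D" "D \<subseteq> J" "x \<in> E D" using U_E[OF x] by blast
    show ?thesis using ideal.Icarr[OF ideal[OF D(1)] D(3)] sub_D[OF D(2)] by blast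
  qed
  have "primeideal U (?B J)"
  proof (rule primeidealI)
    show "ideal U (?B J)"
    proof (rule J.ideal_criterion)
      show "U \<subseteq> carrier (?B J)" using U_carrier by blast
      have "\<zero>\<^bsub>?B (I \<union> {})\<^esub> \<in> E {}"
        by (rule additive_subgroup.zero_closed[OF ideal.axioms(1)[OF ideal]]) simp
      then show "\<zero>\<^bsub>?B J\<^esub> \<in> U" by (intro U_I[of "{}"]) (simp_all add: indexed_poly_ring_simps)
      fix a assume a: "a \<in> U"
      then obtain D where D: "finite D" "D \<subseteq> J" "a \<in> E D" using U_E by blast
      show "a \<oplus>\<^bsub>?B J\<^esub> b \<in> U" if b: "b \<in> U" for b
      proof -
        obtain D' where D': "finite D'" "D' \<subseteq> J" "b \<in> E D'" using U_E[OF b] by blast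
        have fin: "finite (D \<union> D')" using D D' by simp
        have "a \<in> E (D \<union> D')" "b \<in> E (D \<union> D')"
          using mono[OF fin, of D] mono[OF fin, of D'] D(3) D'(3) by auto
        then have "a \<oplus>\<^bsub>?B (I \<union> (D \<union> D'))\<^esub> b \<in> E (D \<union> D')"
          by (rule additive_subgroup.a_closed[OF ideal.axioms(1)[OF ideal[OF fin]]])
        then show ?thesis
          using D D' by (intro U_I[OF fin]) (simp_all add: indexed_poly_ring_simps)
      qed
      show "x \<otimes>\<^bsub>?B J\<^esub> a \<in> U" if x: "x \<in> carrier (?B J)" for x
      proof -
        obtain C where C: "finite C" "C \<subseteq> J" "D \<subseteq> C" "x \<in> carrier (?B (I \<union> C))"
          using common[OF x x D(1,2)] by blast
        have "a \<in> E C" using mono[OF C(1,3)] D(3) by blast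
        then have "x \<otimes>\<^bsub>?B (I \<union> C)\<^esub> a \<in> E C" using C(4) by (rule ideal.I_l_closed[OF ideal[OF C(1)]])
        then show ?thesis by (intro U_I[OF C(1,2)]) (simp add: indexed_poly_ring_simps)
      qed
    qed
    have "\<one>\<^bsub>?B J\<^esub> \<notin> U"
    proof
      assume "\<one>\<^bsub>?B J\<^esub> \<in> U"
      then obtain D where D: "finite D" "\<one>\<^bsub>?B J\<^esub> \<in> E D" using U_E by blast
      then have "\<one>\<^bsub>?B (I \<union> D)\<^esub> \<in> E D" by (simp add: indexed_poly_ring_simps)
      then show False using primeideal.one_notin[OF prime[OF D(1)]] by blast
    qed
    then show "carrier (?B J) \<noteq> U" using J.one_closed by metis
    fix a b assume ab: "a \<in> carrier (?B J)" "b \<in> carrier (?B J)" "a \<otimes>\<^bsub>?B J\<^esub> b \<in> U"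
    obtain D where D: "finite D" "D \<subseteq> J" "a \<otimes>\<^bsub>?B J\<^esub> b \<in> E D" using U_E[OF ab(3)] by blast
    obtain C where C: "finite C" "C \<subseteq> J" "D \<subseteq> C" "a \<in> carrier (?B (I \<union> C))" "b \<in> carrier (?B (I \<union> C))"
      using common[OF ab(1,2) D(1,2)] by blast
    have "a \<otimes>\<^bsub>?B J\<^esub> b \<in> E C" using mono[OF C(1,3)] D(3) by blast
    then have "a \<otimes>\<^bsub>?B (I \<union> C)\<^esub> b \<in> E C" by (simp only: indexed_poly_ring_simps)
    then have "a \<in> E C \<or> b \<in> E C" by (rule primeideal.I_prime[OF prime[OF C(1)] C(4,5)])
    then show "a \<in> U \<or> b \<in> U" using U_I[OF C(1,2)] by blast
  qed (rule J.is_cring)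
  moreover have "contraction (?B I) id U = P"
  proof (rule Set.set_eqI)
    fix x
    have "x \<in> P \<longleftrightarrow> x \<in> carrier (?B I) \<and> x \<in> U"
    proof
      assume "x \<in> P"
      then have "x \<in> carrier (?B I)" "x \<in> E {}" using contr[of "{}" x] by simp_all
      then show "x \<in> carrier (?B I) \<and> x \<in> U" using U_I[of "{}" x] by simp
    next
      assume x: "x \<in> carrier (?B I) \<and> x \<in> U"
      then obtain D where "finite D" "x \<in> E D" using U_E by blast
      then show "x \<in> P" using contr[of D x] x by simp
    qed
    then show "x \<in> contraction (?B I) id U \<longleftrightarrow> x \<in> P" by (simp add: mem_contraction_iff)
  qed
  moreover have "U \<subseteq> Q" if Q: "ideal Q (?B J)" "P \<subseteq> Q" for Q
  proof
    fix x assume "x \<in> U"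
    then obtain D where D: "finite D" "D \<subseteq> J" "x \<in> E D" using U_E by blast
    then show "x \<in> Q" using E_subset[OF D(1) _ Q] sub by blast
  qed
  ultimately show "\<exists>E. primeideal E (?B J) \<and> contraction (?B I) id E = P \<and>
      (\<forall>Q. ideal Q (?B J) \<and> id ` P \<subseteq> Q \<longrightarrow> E \<subseteq> Q)"
    by (intro exI[of _ U]) simp
qed

end

theorem corollary2p4:
  fixes R :: "('a, 'm) ring_scheme" and V :: "'c set"
  assumes "fgfc_ring R"
  shows "fgfc_ring (indexed_poly_ring R V)"
proof -
  interpret cring R using assms by (simp add: fgfc_ring_def)
  let ?B = "indexed_poly_ring R"
  have "finite (minimal_members (prime_locus (?B V) \<one>\<^bsub>?B V\<^esub> F))"
    if F: "finite F" "F \<subseteq> carrier (?B V)" for F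
  proof -
    obtain I where I: "finite I" "I \<subseteq> V" "F \<subseteq> carrier (?B I)"
      using indexed_pset_finite_support_set[OF F(1), of V "carrier R"] F(2)
      unfolding indexed_poly_ring_simps by blast
    have "finite (minimal_members (prime_locus (?B I) \<one>\<^bsub>?B I\<^esub> F))"
      using fgfc_ring_finite_variables[OF assms I(1)] F(1) I(3)
      by (simp add: fgfc_ring_iff cring_indexed_poly_ring)
    then have "finite (minimal_members (prime_locus (?B V) \<one>\<^bsub>?B V\<^esub> (id ` F)))"
      by (rule finite_minimal_members_extension[OF extends_primes_variables[OF I(2)] I(3)])
    then show ?thesis by simp
  qed
  then show ?thesis by (simp add: fgfc_ring_iff cring_indexed_poly_ring)
qed

end
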